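(* For all integers $p, q \ge 0$, $$\pi_1(SO^+(p,q)) \cong \pi_1(SO(p)) \times \pi_1(SO(q)).$$
   Context: For integers $p,q\ge 0$ and $n=p+q$, let $I_{p,q}=\mathrm{diag}(1,\dots,1,-1,\dots,-1)$ be the $n\times n$ diagonal matrix with $p$ entries equal to $1$ followed by $q$ entries equal to $-1$. The indefinite special orthogonal group is $$SO(p,q)=\{A\in GL_n(\mathbb{R}) : A^{-1}=I_{p,q}A^{\top}I_{p,q},\ \det A=1\},$$ with the subspace topology from $GL_n(\mathbb{R})$. $SO^+(p,q)$ denotes the identity component of $SO(p,q)$. $SO(n)=SO(n,0)$ is the usual special orthogonal group ($SO(0)$ and $SO(1)$ are trivial groups). Fundamental groups are taken at the identity element. *)

theory Defs
  imports
    "HOL-Analysis.Analysis"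
    "HOL-Algebra.Group"
    "Jordan_Normal_Form.Determinant"
begin

text \<open>
  The type of matrices contains the matrices of all dimensions. It carries the disjoint sum of the
  entrywise topologies on the sets \<^term>\<open>carrier_mat r c\<close>, so that the subspace topology on
  \<^term>\<open>carrier_mat n n :: real mat set\<close>, and hence on every set of real $n \times n$ matrices, is the
  usual Euclidean one; see \<open>continuous_on_mat_iff\<close> below.
\<close>

definition entrywise_topology :: "nat \<Rightarrow> nat \<Rightarrow> 'a::topological_space mat topology" where
  "entrywise_topology r c =
     pullback_topology (carrier_mat r c) (\<lambda>A. restrict (($$) A) ({..<r} \<times> {..<c}))
       (product_topology (\<lambda>_. euclidean) ({..<r} \<times> {..<c}))"

instantiation mat :: (topological_space) topological_space
begin

definition open_mat :: "'a mat set \<Rightarrow> bool" where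
  "open_mat U \<longleftrightarrow> (\<forall>r c. openin (entrywise_topology r c) (U \<inter> carrier_mat r c))"

instance
proof
  have top: "topspace (entrywise_topology r c) = carrier_mat r c" for r c
    by (auto simp: entrywise_topology_def topspace_pullback_topology)
  show "open (UNIV :: 'a mat set)"
    unfolding open_mat_def Int_UNIV_left top[symmetric] by (intro allI openin_topspace)
  fix U V :: "'a mat set"
  assume "open U" "open V"
  then show "open (U \<inter> V)"
    unfolding open_mat_def
  proof (intro allI)
    fix r c
    have "openin (entrywise_topology r c) (U \<inter> carrier_mat r c)"
      "openin (entrywise_topology r c) (V \<inter> carrier_mat r c)"
      using \<open>open U\<close> \<open>open V\<close> by (simp_all add: open_mat_def)
    from openin_Int[OF this]
    show "openin (entrywise_topology r c) (U \<inter> V \<inter> carrier_mat r c)"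
      by (rule back_subst[where P = "openin _"]) blast
  qed
next
  fix K :: "'a mat set set"
  assume K: "\<forall>U\<in>K. open U"
  show "open (\<Union>K)"
    unfolding open_mat_def
  proof (intro allI)
    fix r c
    have "openin (entrywise_topology r c) (\<Union>((\<lambda>U. U \<inter> carrier_mat r c) ` K))"
      using K unfolding open_mat_def by (intro openin_Union) auto
    then show "openin (entrywise_topology r c) (\<Union>K \<inter> carrier_mat r c)"
      by (rule back_subst[where P = "openin _"]) blast
  qed
qed

end

lemma top_of_set_carrier_mat:
  "top_of_set (carrier_mat r c) = (entrywise_topology r c :: 'a::topological_space mat topology)"
proof (rule topology_eq[THEN iffD2], intro allI iffI)
  fix U :: "'a mat set"
  assume "openin (top_of_set (carrier_mat r c)) U"
  then obtain T where "open T" and U: "U = T \<inter> carrier_mat r c"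
    by (auto simp: openin_open)
  then show "openin (entrywise_topology r c) U"
    unfolding open_mat_def U by blast
next
  fix U :: "'a mat set"
  assume U: "openin (entrywise_topology r c) U"
  have "topspace (entrywise_topology r c :: 'a mat topology) = carrier_mat r c"
    by (auto simp: entrywise_topology_def topspace_pullback_topology)
  then have sub: "U \<subseteq> carrier_mat r c"
    using openin_subset[OF U] by simp
  have "openin (entrywise_topology r' c') (U \<inter> carrier_mat r' c')" for r' c'
  proof (cases "r' = r \<and> c' = c")
    case True
    then show ?thesis using U sub by (simp add: Int_absorb2)
  next
    case False
    then have "U \<inter> carrier_mat r' c' = {}" using sub by auto
    then show ?thesis by simp
  qed
  then have "open U" by (simp add: open_mat_def)
  then show "openin (top_of_set (carrier_mat r c)) U"
    using sub by (rule open_subset[rotated])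
qed

lemma continuous_on_mat_iff:
  fixes f :: "'b::topological_space \<Rightarrow> 'a::topological_space mat"
  assumes "f \<in> S \<rightarrow> carrier_mat r c"
  shows "continuous_on S f \<longleftrightarrow> (\<forall>i<r. \<forall>j<c. continuous_on S (\<lambda>x. f x $$ (i, j)))"
proof -
  let ?I = "{..<r} \<times> {..<c}"
  let ?h = "\<lambda>A :: 'a mat. restrict (($$) A) ?I"
  let ?P = "product_topology (\<lambda>_. euclidean :: 'a topology) ?I"
  have "continuous_on S f \<longleftrightarrow> continuous_map (top_of_set S) (entrywise_topology r c) f"
    unfolding top_of_set_carrier_mat[symmetric] using assms
    by (simp add: image_subset_iff_funcset)
  also have "\<dots> \<longleftrightarrow> continuous_map (top_of_set S) ?P (?h \<circ> f)"
  proof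
    assume "continuous_map (top_of_set S) (entrywise_topology r c) f"
    moreover have "continuous_map (entrywise_topology r c) ?P (id \<circ> ?h)"
      unfolding entrywise_topology_def by (intro continuous_map_pullback) simp
    ultimately show "continuous_map (top_of_set S) ?P (?h \<circ> f)"
      by (simp only: id_o continuous_map_compose)
  next
    assume "continuous_map (top_of_set S) ?P (?h \<circ> f)"
    then show "continuous_map (top_of_set S) (entrywise_topology r c) f"
      unfolding entrywise_topology_def
      by (rule continuous_map_pullback') (use assms in auto)
  qed
  also have "\<dots> \<longleftrightarrow> (\<forall>i<r. \<forall>j<c. continuous_on S (\<lambda>x. f x $$ (i, j)))"
    by (auto simp: continuous_map_componentwise o_def)
  finally show ?thesis .
qed

definition loops_at :: "'a::topological_space set \<Rightarrow> 'a \<Rightarrow> (real \<Rightarrow> 'a) set" where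
  "loops_at S a = {f. path f \<and> path_image f \<subseteq> S \<and> pathstart f = a \<and> pathfinish f = a}"

definition loop_homotopy :: "'a::topological_space set \<Rightarrow> 'a \<Rightarrow> ((real \<Rightarrow> 'a) \<times> (real \<Rightarrow> 'a)) set" where
  "loop_homotopy S a = {(f, g). f \<in> loops_at S a \<and> g \<in> loops_at S a \<and> homotopic_paths S f g}"

text \<open>
  The fundamental group of the subspace \<open>S\<close> at \<open>a\<close>. The union in the multiplication is over
  representatives that all give the same class; see \<open>fundamental_group_mult\<close> below.
\<close>

definition fundamental_group ::
    "'a::topological_space set \<Rightarrow> 'a \<Rightarrow> (real \<Rightarrow> 'a) set monoid" where
  "fundamental_group S a =
     \<lparr>carrier = loops_at S a // loop_homotopy S a,
      mult = (\<lambda>F G. \<Union>f\<in>F. \<Union>g\<in>G. loop_homotopy S a `` {f +++ g}),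
      one = loop_homotopy S a `` {\<lambda>_. a}\<rparr>"

lemma equiv_loop_homotopy: "equiv (loops_at S a) (loop_homotopy S a)"
  by (rule equivI)
    (auto simp: loop_homotopy_def loops_at_def refl_on_def sym_def trans_def
      intro: homotopic_paths_sym homotopic_paths_trans)

lemma loops_at_join: "f \<in> loops_at S a \<Longrightarrow> g \<in> loops_at S a \<Longrightarrow> f +++ g \<in> loops_at S a"
  by (auto simp: loops_at_def path_image_join)

lemma fundamental_group_mult:
  assumes "f \<in> loops_at S a" "g \<in> loops_at S a"
  shows "(loop_homotopy S a `` {f}) \<otimes>\<^bsub>fundamental_group S a\<^esub> (loop_homotopy S a `` {g}) =
    loop_homotopy S a `` {f +++ g}"
proof -
  have "congruent2 (loop_homotopy S a) (loop_homotopy S a)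
      (\<lambda>f g. loop_homotopy S a `` {f +++ g})"
  proof (rule congruent2I')
    fix f f' g g'
    assume "(f, f') \<in> loop_homotopy S a" "(g, g') \<in> loop_homotopy S a"
    then have "(f +++ g, f' +++ g') \<in> loop_homotopy S a"
      by (auto simp: loop_homotopy_def loops_at_join)
        (auto simp: loops_at_def intro: homotopic_paths_join)
    then show "loop_homotopy S a `` {f +++ g} = loop_homotopy S a `` {f' +++ g'}"
      by (rule equiv_class_eq[OF equiv_loop_homotopy])
  qed
  from UN_equiv_class2[OF equiv_loop_homotopy equiv_loop_homotopy this assms]
  show ?thesis by (simp add: fundamental_group_def)
qed

lemma group_fundamental_group:
  assumes "a \<in> S"
  shows "group (fundamental_group S a)"
proof -
  let ?R = "loop_homotopy S a" and ?L = "loops_at S a" and ?G = "fundamental_group S a"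
  have carr: "carrier ?G = ?L // ?R" and one: "\<one>\<^bsub>?G\<^esub> = ?R `` {\<lambda>_. a}"
    by (simp_all add: fundamental_group_def)
  have cls: "?R `` {f} = ?R `` {g}" if "f \<in> ?L" "g \<in> ?L" "homotopic_paths S f g" for f g
    using that by (intro equiv_class_eq[OF equiv_loop_homotopy]) (simp add: loop_homotopy_def)
  have const: "(\<lambda>_. a) \<in> ?L"
    using assms by (auto simp: loops_at_def path_def path_image_def pathstart_def pathfinish_def)
  have ex: thesis if "F \<in> carrier ?G" "\<And>f. f \<in> ?L \<Longrightarrow> F = ?R `` {f} \<Longrightarrow> thesis" for F thesis
    using that by (auto simp: carr elim: quotientE)
  have mem: "?R `` {f} \<in> carrier ?G" if "f \<in> ?L" for f
    using that by (auto simp: carr intro: quotientI)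
  have lid: "homotopic_paths S ((\<lambda>_. a) +++ f) f" if "f \<in> ?L" for f
  proof -
    have f: "continuous_on {0..1} (\<lambda>t::real. if t \<le> 1/2 then 0 else 2 * t - 1)"
      unfolding split_01
      by (rule continuous_on_cases continuous_intros | force)+
    show ?thesis
      by (rule homotopic_paths_sym,
          rule homotopic_paths_reparametrize[where f = "\<lambda>t. if t \<le> 1/2 then 0 else 2 * t - 1"])
        (use that f in \<open>auto simp: loops_at_def joinpaths_def pathstart_def\<close>)
  qed
  have linv: "homotopic_paths S (reversepath f +++ f) (\<lambda>_. a)" if "f \<in> ?L" for f
  proof -
    have p: "continuous_on {0..1} f"
      using that by (auto simp: loops_at_def path_def)
    define A where "A = {0..1::real} \<times> {0..1::real}"
    define k where "k = (\<lambda>x. if snd x \<le> 1/2 then f (1 - 2 * snd x * (1 - fst x))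
                           else f (1 - (2 - 2 * snd x) * (1 - fst x)))"
    have range: "1 - u * v \<in> {0..1}" if "0 \<le> u" "u \<le> 1" "0 \<le> v" "v \<le> 1" for u v :: real
      using that by (simp add: mult_le_one)
    have range1: "1 - 2 * snd x * (1 - fst x) \<in> {0..1}" if "x \<in> A" "snd x \<le> 1/2" for x
      by (rule range) (use that in \<open>auto simp: A_def\<close>)
    have range2: "1 - (2 - 2 * snd x) * (1 - fst x) \<in> {0..1}" if "x \<in> A" "1/2 \<le> snd x" for x
      by (rule range) (use that in \<open>auto simp: A_def\<close>)
    have "continuous_on A k"
      unfolding k_def
    proof (rule continuous_on_cases_le)
      show "continuous_on {x \<in> A. snd x \<le> 1/2} (\<lambda>x. f (1 - 2 * snd x * (1 - fst x)))"
        by (rule continuous_on_compose2[OF p])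
          (use range1 in \<open>intro continuous_intros, blast\<close>)
      show "continuous_on {x \<in> A. 1/2 \<le> snd x} (\<lambda>x. f (1 - (2 - 2 * snd x) * (1 - fst x)))"
        by (rule continuous_on_compose2[OF p])
          (use range2 in \<open>intro continuous_intros, blast\<close>)
      show "continuous_on A snd" by (intro continuous_intros)
      show "f (1 - 2 * snd x * (1 - fst x)) = f (1 - (2 - 2 * snd x) * (1 - fst x))"
        if "x \<in> A" "snd x = 1/2" for x
        by (simp add: that(2))
    qed
    moreover have "k \<in> A \<rightarrow> S"
    proof
      fix x assume x: "x \<in> A"
      have S: "f t \<in> S" if "t \<in> {0..1}" for t
        using \<open>f \<in> ?L\<close> that by (auto simp: loops_at_def path_image_def)
      show "k x \<in> S"
        using S[OF range1[OF x]] S[OF range2[OF x]] by (simp add: k_def)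
    qed
    moreover have "f 0 = a" "f 1 = a"
      using that by (auto simp: loops_at_def pathstart_def pathfinish_def)
    moreover have "k (0, x) = (reversepath f +++ f) x" for x
      by (simp add: k_def joinpaths_def reversepath_def)
    ultimately show ?thesis
      unfolding homotopic_paths A_def[symmetric]
      by (intro exI[of _ k])
        (simp add: k_def joinpaths_def reversepath_def pathstart_def pathfinish_def)
  qed
  have rev: "reversepath f \<in> ?L" if "f \<in> ?L" for f
    using that by (auto simp: loops_at_def)
  show ?thesis
  proof (rule groupI)
    show "\<one>\<^bsub>?G\<^esub> \<in> carrier ?G" using const mem one by simp
  next
    fix F G assume "F \<in> carrier ?G" "G \<in> carrier ?G"
    then show "F \<otimes>\<^bsub>?G\<^esub> G \<in> carrier ?G"
      by (elim ex) (simp add: fundamental_group_mult loops_at_join mem)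
  next
    fix F G H assume "F \<in> carrier ?G" "G \<in> carrier ?G" "H \<in> carrier ?G"
    from \<open>F \<in> _\<close> obtain f where f: "f \<in> ?L" "F = ?R `` {f}" by (rule ex)
    from \<open>G \<in> _\<close> obtain g where g: "g \<in> ?L" "G = ?R `` {g}" by (rule ex)
    from \<open>H \<in> _\<close> obtain h where h: "h \<in> ?L" "H = ?R `` {h}" by (rule ex)
    have "homotopic_paths S ((f +++ g) +++ h) (f +++ (g +++ h))"
      using f g h by (intro homotopic_paths_sym[OF homotopic_paths_assoc]) (simp_all add: loops_at_def)
    then show "F \<otimes>\<^bsub>?G\<^esub> G \<otimes>\<^bsub>?G\<^esub> H = F \<otimes>\<^bsub>?G\<^esub> (G \<otimes>\<^bsub>?G\<^esub> H)"
      using f g h by (simp add: fundamental_group_mult loops_at_join cls)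
  next
    fix F assume "F \<in> carrier ?G"
    then obtain f where f: "f \<in> ?L" "F = ?R `` {f}" by (rule ex)
    show "\<one>\<^bsub>?G\<^esub> \<otimes>\<^bsub>?G\<^esub> F = F"
      using f const by (simp add: one fundamental_group_mult loops_at_join cls lid)
    show "\<exists>H\<in>carrier ?G. H \<otimes>\<^bsub>?G\<^esub> F = \<one>\<^bsub>?G\<^esub>"
      using f const rev[OF f(1)] linv[OF f(1)]
      by (intro bexI[of _ "?R `` {reversepath f}"])
        (simp_all add: one fundamental_group_mult loops_at_join cls mem)
  qed
qed

definition GL :: "nat \<Rightarrow> real mat set" where
  "GL n = {A \<in> carrier_mat n n. invertible_mat A}"

definition sig_mat :: "nat \<Rightarrow> nat \<Rightarrow> real mat" where
  "sig_mat p q = mat_diag (p + q) (\<lambda>i. if i < p then 1 else - 1)"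

text \<open>The two \<^const>\<open>inverts_mat\<close> conditions say that the inverse of \<open>A\<close> is \<open>B\<close>.\<close>

definition SOpq :: "nat \<Rightarrow> nat \<Rightarrow> real mat set" where
  "SOpq p q = {A \<in> GL (p + q).
     (let B = sig_mat p q * transpose_mat A * sig_mat p q in inverts_mat A B \<and> inverts_mat B A) \<and>
     Determinant.det A = 1}"

definition SOpq_plus :: "nat \<Rightarrow> nat \<Rightarrow> real mat set" where
  "SOpq_plus p q = connected_component_set (SOpq p q) (1\<^sub>m (p + q))"

definition SO :: "nat \<Rightarrow> real mat set" where
  "SO n = SOpq n 0"

lemma one_mat_in_SOpq: "1\<^sub>m (p + q) \<in> SOpq p q"
proof -
  have sq: "sig_mat p q * sig_mat p q = 1\<^sub>m (p + q)"
    unfolding sig_mat_def mat_diag_diag by (auto simp: mat_diag_def)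
  have dim: "sig_mat p q \<in> carrier_mat (p + q) (p + q)"
    by (simp add: sig_mat_def)
  have "invertible_mat (1\<^sub>m (p + q) :: real mat)"
    unfolding invertible_mat_def inverts_mat_def by (auto intro!: exI[of _ "1\<^sub>m (p + q)"])
  then show ?thesis
    using dim by (simp add: SOpq_def GL_def inverts_mat_def Let_def sq)
qed

end

theory Submission
  imports Defs
begin

text \<open>
  Write \<open>A \<in> O(p,q)\<close> in blocks \<open>a, b, c, d\<close> according to $n = p + q$. Then \<open>A\<^sup>T I A = I\<close> for
  \<open>I = diag(1, -1)\<close> says
  \[ a^T a = 1 + c^T c, \qquad d^T d = 1 + b^T b, \qquad a^T b = c^T d . \]
  Scale the off-diagonal blocks by $t \in [0,1]$. The last equation survives, so the first $p$ columns
  stay orthogonal to the last $q$ columns for the indefinite form, and the Gram matrices of the two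
  groups of columns are $1 + (1 - t^2) c^T c$ and $-(1 + (1 - t^2) b^T b)$, which are definite for
  every $t$. Orthonormalising each group of columns separately, as in the Gram-Schmidt process,
  therefore leads back into \<open>O(p,q)\<close>. At $t = 1$ nothing is changed, at $t = 0$ the result is block
  diagonal, and block diagonal elements (the identity in particular) never move. So \<open>O(p,q)\<close>
  deformation retracts onto \<open>O(p) \<times> O(q)\<close>, and the two have the same fundamental group:
  \<open>fundamental_group_indef_orthogonal\<close>.

  Orthonormalising takes a continuous map $L$ on the positive definite matrices with
  $L(G)^T G\, L(G) = 1$ and $L(1) = 1$; this is \<open>continuous_congruence_to_one\<close>, where $L(G)$ is the
  upper triangular inverse Cholesky factor, built by induction on the size with Schur complements. It
  plays the part that the inverse square root of $G$ has in the polar decomposition; unlike the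
  square root, it is given by explicit formulas whose continuity can be read off.

  The fundamental group sees only the component of the base point
  (\<open>fundamental_group_connected_component\<close>), and on the component of 1 in \<open>O(p,q)\<close> the determinant is
  constantly 1, being continuous with values in $\{1, -1\}$. Hence \<open>SO\<^sup>+(p,q)\<close>, \<open>SO(p)\<close> and \<open>SO(q)\<close> may be
  replaced by \<open>O(p,q)\<close>, \<open>O(p)\<close> and \<open>O(q)\<close>. What remains is
  \<open>fundamental_group_Times\<close>: fundamental groups commute with products.
\<close>

section \<open>Fundamental groups\<close>

definition path_class :: "'a::topological_space set \<Rightarrow> 'a \<Rightarrow> (real \<Rightarrow> 'a) \<Rightarrow> (real \<Rightarrow> 'a) set" where
  "path_class S a f = loop_homotopy S a `` {f}"

lemma path_class_eq_iff:
  assumes "f \<in> loops_at S a" "g \<in> loops_at S a"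
  shows "path_class S a f = path_class S a g \<longleftrightarrow> homotopic_paths S f g"
  unfolding path_class_def eq_equiv_class_iff[OF equiv_loop_homotopy assms]
  using assms by (simp add: loop_homotopy_def)

lemma path_class_in_carrier:
  "f \<in> loops_at S a \<Longrightarrow> path_class S a f \<in> carrier (fundamental_group S a)"
  by (simp add: path_class_def fundamental_group_def quotientI)

lemma fundamental_group_cases:
  assumes "C \<in> carrier (fundamental_group S a)"
  obtains f where "f \<in> loops_at S a" "C = path_class S a f"
proof -
  have "C \<in> loops_at S a // loop_homotopy S a"
    using assms by (simp add: fundamental_group_def)
  then show thesis
    by (rule quotientE) (rule that, simp_all add: path_class_def)
qed

lemma path_class_mult:
  "f \<in> loops_at S a \<Longrightarrow> g \<in> loops_at S a \<Longrightarrow>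
    path_class S a f \<otimes>\<^bsub>fundamental_group S a\<^esub> path_class S a g = path_class S a (f +++ g)"
  unfolding path_class_def by (rule fundamental_group_mult)

lemma loops_at_compose:
  assumes "f \<in> loops_at S a" "continuous_on S F" "F \<in> S \<rightarrow> T" "F a = b"
  shows "F \<circ> f \<in> loops_at T b"
  using assms path_continuous_image[of f F] continuous_on_subset[of S F "path_image f"]
  by (auto simp: loops_at_def path_image_compose pathstart_compose pathfinish_compose)

text \<open>
  Composing with \<open>F\<close> sends the class \<open>C\<close> to a set of loops in \<open>T\<close> that is in general only part of
  a class; its image under the homotopy relation is the whole class.
\<close>

definition induced_map ::
    "'a::topological_space set \<Rightarrow> 'a \<Rightarrow> 'b::topological_space set \<Rightarrow> 'b \<Rightarrow> ('a \<Rightarrow> 'b) \<Rightarrow>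
      (real \<Rightarrow> 'a) set \<Rightarrow> (real \<Rightarrow> 'b) set" where
  "induced_map S a T b F C = loop_homotopy T b `` ((\<circ>) F ` C)"

lemma induced_map_path_class:
  assumes "continuous_on S F" "F \<in> S \<rightarrow> T" "F a = b" and f: "f \<in> loops_at S a"
  shows "induced_map S a T b F (path_class S a f) = path_class T b (F \<circ> f)"
proof -
  have "path_class T b (F \<circ> g) = path_class T b (F \<circ> f)" if "g \<in> path_class S a f" for g
  proof -
    have "g \<in> loops_at S a" "homotopic_paths S g f"
      using that by (simp_all add: path_class_def loop_homotopy_def homotopic_paths_sym_eq)
    then show ?thesis
      using assms by (simp add: path_class_eq_iff loops_at_compose homotopic_paths_continuous_image)
  qed
  moreover have "f \<in> path_class S a f"
    using f by (simp add: path_class_def loop_homotopy_def loops_at_def)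
  ultimately have "(\<Union>g\<in>path_class S a f. path_class T b (F \<circ> g)) = path_class T b (F \<circ> f)"
    by blast
  then show ?thesis
    unfolding induced_map_def path_class_def by blast
qed

lemma induced_map_hom:
  assumes "continuous_on S F" "F \<in> S \<rightarrow> T" "F a = b"
  shows "induced_map S a T b F \<in> hom (fundamental_group S a) (fundamental_group T b)"
proof (rule homI)
  fix C assume "C \<in> carrier (fundamental_group S a)"
  then obtain f where f: "f \<in> loops_at S a" "C = path_class S a f"
    by (rule fundamental_group_cases)
  show "induced_map S a T b F C \<in> carrier (fundamental_group T b)"
    unfolding f(2) induced_map_path_class[OF assms f(1)]
    by (intro path_class_in_carrier loops_at_compose[OF f(1) assms])
next
  fix C D
  assume "C \<in> carrier (fundamental_group S a)" "D \<in> carrier (fundamental_group S a)"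
  from \<open>C \<in> _\<close> obtain f where f: "f \<in> loops_at S a" "C = path_class S a f"
    by (rule fundamental_group_cases)
  from \<open>D \<in> _\<close> obtain g where g: "g \<in> loops_at S a" "D = path_class S a g"
    by (rule fundamental_group_cases)
  note F = loops_at_compose[OF _ assms] induced_map_path_class[OF assms]
  show "induced_map S a T b F (C \<otimes>\<^bsub>fundamental_group S a\<^esub> D) =
      induced_map S a T b F C \<otimes>\<^bsub>fundamental_group T b\<^esub> induced_map S a T b F D"
    unfolding f(2) g(2) path_class_mult[OF f(1) g(1)] F(2)[OF f(1)] F(2)[OF g(1)]
      F(2)[OF loops_at_join[OF f(1) g(1)]] path_class_mult[OF F(1)[OF f(1)] F(1)[OF g(1)]]
    by (simp add: path_compose_join)
qed

text \<open>
  The maps induced by \<open>F\<close> and \<open>E\<close> are inverse to each other. The homotopy from \<open>E \<circ> F\<close> to the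
  identity has to fix the base point: precomposed with a loop, it is then a homotopy of loops
  with fixed end points.
\<close>

theorem fundamental_group_deformation_retract:
  assumes F: "continuous_on S F" "F \<in> S \<rightarrow> T" and E: "continuous_on T E" "E \<in> T \<rightarrow> S"
    and EF: "homotopic_with_canon (\<lambda>k. k a = a) S S (E \<circ> F) id"
    and FE: "\<And>y. y \<in> T \<Longrightarrow> F (E y) = y"
    and base: "F a = b" "E b = a"
  shows "fundamental_group S a \<cong> fundamental_group T b"
proof (rule is_isoI, rule isoI)
  note F_loop = loops_at_compose[OF _ F base(1)] and E_loop = loops_at_compose[OF _ E base(2)]
  note F_class = induced_map_path_class[OF F base(1)] and E_class = induced_map_path_class[OF E base(2)]
  show "induced_map S a T b F \<in> hom (fundamental_group S a) (fundamental_group T b)"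
    by (rule induced_map_hom[OF F base(1)])
  show "bij_betw (induced_map S a T b F)
      (carrier (fundamental_group S a)) (carrier (fundamental_group T b))"
  proof (rule bij_betwI)
    show "induced_map S a T b F \<in> carrier (fundamental_group S a) \<rightarrow> carrier (fundamental_group T b)"
      using induced_map_hom[OF F base(1)] by (auto simp: hom_def)
    show "induced_map T b S a E \<in> carrier (fundamental_group T b) \<rightarrow> carrier (fundamental_group S a)"
      using induced_map_hom[OF E base(2)] by (auto simp: hom_def)
  next
    fix C assume "C \<in> carrier (fundamental_group S a)"
    then obtain f where f: "f \<in> loops_at S a" "C = path_class S a f"
      by (rule fundamental_group_cases)
    have "homotopic_with_canon (\<lambda>r. pathstart r = pathstart (E \<circ> F \<circ> f) \<and>
        pathfinish r = pathfinish (E \<circ> F \<circ> f)) {0..1} S ((E \<circ> F) \<circ> f) (id \<circ> f)"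
    proof (rule homotopic_with_compose_continuous_right)
      show "homotopic_with_canon (\<lambda>k. pathstart (k \<circ> f) = pathstart (E \<circ> F \<circ> f) \<and>
          pathfinish (k \<circ> f) = pathfinish (E \<circ> F \<circ> f)) S S (E \<circ> F) id"
        by (rule homotopic_with_mono[OF EF])
          (use f(1) base in \<open>auto simp: loops_at_def pathstart_def pathfinish_def\<close>)
      show "continuous_on {0..1} f" "f \<in> {0..1} \<rightarrow> S"
        using f(1) by (auto simp: loops_at_def path_def path_image_def)
    qed
    then have "homotopic_paths S (E \<circ> (F \<circ> f)) f"
      by (simp add: homotopic_paths_def comp_assoc)
    then show "induced_map T b S a E (induced_map S a T b F C) = C"
      unfolding f(2) F_class[OF f(1)] E_class[OF F_loop[OF f(1)]]
      using path_class_eq_iff[OF E_loop[OF F_loop[OF f(1)]] f(1)] by blast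
  next
    fix D assume "D \<in> carrier (fundamental_group T b)"
    then obtain g where g: "g \<in> loops_at T b" "D = path_class T b g"
      by (rule fundamental_group_cases)
    have "homotopic_paths T (F \<circ> (E \<circ> g)) g"
    proof (rule homotopic_paths_eq)
      show "path (F \<circ> (E \<circ> g))" "path_image (F \<circ> (E \<circ> g)) \<subseteq> T"
        using F_loop[OF E_loop[OF g(1)]] by (simp_all add: loops_at_def)
      show "(F \<circ> (E \<circ> g)) t = g t" if "t \<in> {0..1}" for t
        using that g(1) by (auto simp: loops_at_def path_image_def intro!: FE)
    qed
    then show "induced_map S a T b F (induced_map T b S a E D) = D"
      unfolding g(2) E_class[OF g(1)] F_class[OF E_loop[OF g(1)]]
      using path_class_eq_iff[OF F_loop[OF E_loop[OF g(1)]] g(1)] by blast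
  qed
qed

lemma loops_at_Pair:
  assumes "f \<in> loops_at S a" "g \<in> loops_at T b"
  shows "(\<lambda>t. (f t, g t)) \<in> loops_at (S \<times> T) (a, b)"
  using assms
  by (auto simp: loops_at_def path_def path_image_def pathstart_def pathfinish_def
      intro: continuous_on_Pair)

lemma homotopic_paths_Pair:
  assumes "homotopic_paths S f f'" "homotopic_paths T g g'"
  shows "homotopic_paths (S \<times> T) (\<lambda>t. (f t, g t)) (\<lambda>t. (f' t, g' t))"
proof -
  obtain h where h: "continuous_on ({0..1} \<times> {0..1}) h" "h \<in> {0..1} \<times> {0..1} \<rightarrow> S"
      "\<forall>x\<in>{0..1}. h (0, x) = f x" "\<forall>x\<in>{0..1}. h (1, x) = f' x"
    and h_ends: "\<forall>t\<in>{0..1::real}. pathstart (h \<circ> Pair t) = pathstart f \<and> pathfinish (h \<circ> Pair t) = pathfinish f"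
    using assms(1) unfolding homotopic_paths by (elim exE conjE) (rule that)
  obtain k where k: "continuous_on ({0..1} \<times> {0..1}) k" "k \<in> {0..1} \<times> {0..1} \<rightarrow> T"
      "\<forall>x\<in>{0..1}. k (0, x) = g x" "\<forall>x\<in>{0..1}. k (1, x) = g' x"
    and k_ends: "\<forall>t\<in>{0..1::real}. pathstart (k \<circ> Pair t) = pathstart g \<and> pathfinish (k \<circ> Pair t) = pathfinish g"
    using assms(2) unfolding homotopic_paths by (elim exE conjE) (rule that)
  show ?thesis
    unfolding homotopic_paths
  proof (intro exI[of _ "\<lambda>z. (h z, k z)"] conjI)
    show "continuous_on ({0..1} \<times> {0..1}) (\<lambda>z. (h z, k z))"
      by (intro continuous_on_Pair h(1) k(1))
    show "(\<lambda>z. (h z, k z)) \<in> {0..1} \<times> {0..1} \<rightarrow> S \<times> T"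
      using h(2) k(2) by blast
    show "\<forall>t\<in>{0..1::real}. pathstart ((\<lambda>z. (h z, k z)) \<circ> Pair t) = pathstart (\<lambda>t. (f t, g t)) \<and>
        pathfinish ((\<lambda>z. (h z, k z)) \<circ> Pair t) = pathfinish (\<lambda>t. (f t, g t))"
      using h_ends k_ends by (simp add: pathstart_def pathfinish_def)
  qed (use h(3,4) k(3,4) in simp_all)
qed

text \<open>
  Loops and homotopies in a product are pairs of loops and of homotopies in the factors, so the maps
  induced by the two projections are jointly bijective.
\<close>

theorem fundamental_group_Times:
  fixes S :: "'a::topological_space set" and T :: "'b::topological_space set"
  assumes "a \<in> S" "b \<in> T"
  shows "fundamental_group (S \<times> T) (a, b) \<cong> fundamental_group S a \<times>\<times> fundamental_group T b"
proof -
  let ?P = "fundamental_group (S \<times> T) (a, b)"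
  let ?h = "\<lambda>C. (induced_map (S \<times> T) (a, b) S a fst C, induced_map (S \<times> T) (a, b) T b snd C)"
  have fst: "continuous_on (S \<times> T) fst" "fst \<in> S \<times> T \<rightarrow> S" "fst (a, b) = a"
    and snd: "continuous_on (S \<times> T) snd" "snd \<in> S \<times> T \<rightarrow> T" "snd (a, b) = b"
    by (auto intro: continuous_intros)
  have hom: "?h \<in> hom ?P (fundamental_group S a \<times>\<times> fundamental_group T b)"
    using induced_map_hom[OF fst] induced_map_hom[OF snd] by (simp add: hom_paired)
  have h: "?h (path_class (S \<times> T) (a, b) f) = (path_class S a (fst \<circ> f), path_class T b (snd \<circ> f))"
    if "f \<in> loops_at (S \<times> T) (a, b)" for f
    by (simp add: induced_map_path_class[OF fst that] induced_map_path_class[OF snd that])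
  have "inj_on ?h (carrier ?P)"
  proof (rule inj_onI)
    fix C D assume "C \<in> carrier ?P" "D \<in> carrier ?P" and eq: "?h C = ?h D"
    from \<open>C \<in> _\<close> obtain f where f: "f \<in> loops_at (S \<times> T) (a, b)" "C = path_class (S \<times> T) (a, b) f"
      by (rule fundamental_group_cases)
    from \<open>D \<in> _\<close> obtain g where g: "g \<in> loops_at (S \<times> T) (a, b)" "D = path_class (S \<times> T) (a, b) g"
      by (rule fundamental_group_cases)
    have "homotopic_paths S (fst \<circ> f) (fst \<circ> g)" "homotopic_paths T (snd \<circ> f) (snd \<circ> g)"
      using eq unfolding f(2) g(2) h[OF f(1)] h[OF g(1)]
      by (simp_all add: path_class_eq_iff loops_at_compose[OF f(1) fst] loops_at_compose[OF g(1) fst]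
          loops_at_compose[OF f(1) snd] loops_at_compose[OF g(1) snd])
    from homotopic_paths_Pair[OF this] have "homotopic_paths (S \<times> T) f g"
      by simp
    then show "C = D" using f g by (simp only: path_class_eq_iff)
  qed
  moreover have "?h ` carrier ?P = carrier (fundamental_group S a \<times>\<times> fundamental_group T b)"
  proof
    show "?h ` carrier ?P \<subseteq> carrier (fundamental_group S a \<times>\<times> fundamental_group T b)"
      using hom unfolding hom_def by blast
    show "carrier (fundamental_group S a \<times>\<times> fundamental_group T b) \<subseteq> ?h ` carrier ?P"
    proof clarify
      fix C D assume "(C, D) \<in> carrier (fundamental_group S a \<times>\<times> fundamental_group T b)"
      then have "C \<in> carrier (fundamental_group S a)" "D \<in> carrier (fundamental_group T b)"
        by (simp_all add: DirProd_def)
      from this(1) obtain f where f: "f \<in> loops_at S a" "C = path_class S a f"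
        by (rule fundamental_group_cases)
      from \<open>D \<in> _\<close> obtain g where g: "g \<in> loops_at T b" "D = path_class T b g"
        by (rule fundamental_group_cases)
      have "?h (path_class (S \<times> T) (a, b) (\<lambda>t. (f t, g t))) = (C, D)"
        unfolding h[OF loops_at_Pair[OF f(1) g(1)]] by (simp add: f(2) g(2) o_def)
      then show "(C, D) \<in> ?h ` carrier ?P"
        using path_class_in_carrier[OF loops_at_Pair[OF f(1) g(1)]] by (intro rev_image_eqI) auto
    qed
  qed
  ultimately show ?thesis
    using hom by (intro is_isoI[OF isoI]) (simp_all add: bij_betw_def)
qed

text \<open>
  Loops at \<open>a\<close>, and homotopies between them, are continuous images of connected sets through
  \<open>a\<close>, so they cannot leave the component of \<open>a\<close>. Both groups are therefore the same set of
  classes, and the conclusion is an equality.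
\<close>

lemma fundamental_group_connected_component:
  assumes comp: "connected_component_set S a \<subseteq> T" and sub: "T \<subseteq> S"
  shows "fundamental_group T a = fundamental_group S a"
proof -
  have in_comp: "K \<subseteq> T" if "connected K" "K \<subseteq> S" "a \<in> K" for K
    using connected_component_maximal[OF that(3,1,2)] comp by blast
  have loops: "loops_at T a = loops_at S a"
    using sub in_comp[OF connected_path_image] pathstart_in_path_image
    unfolding loops_at_def by (smt (verit, ccfv_SIG) Collect_cong order_trans)
  have "homotopic_paths T f g" if fg: "homotopic_paths S f g" and f: "f \<in> loops_at S a" for f g
  proof -
    obtain h where h: "continuous_on ({0..1} \<times> {0..1}) h" "h \<in> ({0..1} \<times> {0..1}) \<rightarrow> S"
      "\<forall>x\<in>{0..1}. h (0, x) = f x" "\<forall>x\<in>{0..1}. h (1, x) = g x"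
      "\<forall>t\<in>{0..1::real}. pathstart (h \<circ> Pair t) = pathstart f \<and> pathfinish (h \<circ> Pair t) = pathfinish f"
      using fg unfolding homotopic_paths by (elim exE conjE) (rule that)
    have "connected (h ` ({0..1} \<times> {0..1}))"
      by (intro connected_continuous_image h(1) connected_Times) auto
    moreover have "a \<in> h ` ({0..1} \<times> {0..1})"
      using h(3) f by (intro rev_image_eqI[of "(0, 0)"]) (auto simp: loops_at_def pathstart_def)
    ultimately have "h ` ({0..1} \<times> {0..1}) \<subseteq> T"
      using h(2) by (intro in_comp) auto
    then show ?thesis
      unfolding homotopic_paths using h by (intro exI[of _ h]) auto
  qed
  then have "loop_homotopy T a = loop_homotopy S a"
    using homotopic_paths_subset[OF _ sub] by (auto simp: loop_homotopy_def loops)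
  then show ?thesis
    by (simp add: fundamental_group_def loops)
qed

section \<open>Continuity of matrix operations\<close>

lemma continuous_on_entry:
  fixes f :: "'b::topological_space \<Rightarrow> 'a::topological_space mat"
  assumes "continuous_on S f" "f \<in> S \<rightarrow> carrier_mat r c" "i < r" "j < c"
  shows "continuous_on S (\<lambda>x. f x $$ (i, j))"
  using assms continuous_on_mat_iff by blast

lemma continuous_on_mat_mult:
  fixes f g :: "'b::topological_space \<Rightarrow> 'a::real_normed_algebra mat"
  assumes "continuous_on S f" "f \<in> S \<rightarrow> carrier_mat n m"
    and "continuous_on S g" "g \<in> S \<rightarrow> carrier_mat m k"
  shows "continuous_on S (\<lambda>x. f x * g x)"
proof -
  have "continuous_on S (\<lambda>x. (f x * g x) $$ (i, j))" if "i < n" "j < k" for i j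
  proof (rule iffD1[OF continuous_on_cong[OF refl]])
    show "continuous_on S (\<lambda>x. \<Sum>l<m. f x $$ (i, l) * g x $$ (l, j))"
      using that by (intro continuous_intros continuous_on_entry[OF assms(1,2)]
        continuous_on_entry[OF assms(3,4)]) auto
    show "(\<Sum>l<m. f x $$ (i, l) * g x $$ (l, j)) = (f x * g x) $$ (i, j)" if "x \<in> S" for x
    proof -
      have "f x \<in> carrier_mat n m" "g x \<in> carrier_mat m k" using assms that by auto
      then show ?thesis using \<open>i < n\<close> \<open>j < k\<close> by (simp add: scalar_prod_def lessThan_atLeast0)
    qed
  qed
  then show ?thesis using assms
    by (subst continuous_on_mat_iff[of _ _ n k]) (auto intro!: mult_carrier_mat)
qed

lemma continuous_on_mat_add:
  fixes f g :: "'b::topological_space \<Rightarrow> 'a::real_normed_algebra mat"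
  assumes "continuous_on S f" "f \<in> S \<rightarrow> carrier_mat n m"
    and "continuous_on S g" "g \<in> S \<rightarrow> carrier_mat n m"
  shows "continuous_on S (\<lambda>x. f x + g x)"
proof -
  have "continuous_on S (\<lambda>x. (f x + g x) $$ (i, j))" if "i < n" "j < m" for i j
  proof (rule iffD1[OF continuous_on_cong[OF refl]])
    show "continuous_on S (\<lambda>x. f x $$ (i, j) + g x $$ (i, j))"
      using that by (intro continuous_intros continuous_on_entry[OF assms(1,2)]
        continuous_on_entry[OF assms(3,4)]) auto
    show "f x $$ (i, j) + g x $$ (i, j) = (f x + g x) $$ (i, j)" if "x \<in> S" for x
    proof -
      have "f x \<in> carrier_mat n m" "g x \<in> carrier_mat n m" using assms that by auto
      then show ?thesis using \<open>i < n\<close> \<open>j < m\<close> by simp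
    qed
  qed
  then show ?thesis using assms
    by (subst continuous_on_mat_iff[of _ _ n m]) (auto intro!: add_carrier_mat)
qed

lemma continuous_on_mat_smult:
  fixes f :: "'b::topological_space \<Rightarrow> 'a::real_normed_algebra mat"
  assumes "continuous_on S s" "continuous_on S f" "f \<in> S \<rightarrow> carrier_mat n m"
  shows "continuous_on S (\<lambda>x. s x \<cdot>\<^sub>m f x)"
proof -
  have "continuous_on S (\<lambda>x. (s x \<cdot>\<^sub>m f x) $$ (i, j))" if "i < n" "j < m" for i j
  proof (rule iffD1[OF continuous_on_cong[OF refl]])
    show "continuous_on S (\<lambda>x. s x * f x $$ (i, j))"
      using that by (intro continuous_intros continuous_on_entry[OF assms(2,3)] assms(1)) auto
    show "s x * f x $$ (i, j) = (s x \<cdot>\<^sub>m f x) $$ (i, j)" if "x \<in> S" for x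
    proof -
      have "f x \<in> carrier_mat n m" using assms that by auto
      then show ?thesis using \<open>i < n\<close> \<open>j < m\<close> by simp
    qed
  qed
  then show ?thesis using assms
    by (subst continuous_on_mat_iff[of _ _ n m]) (auto intro!: smult_carrier_mat)
qed

lemma continuous_on_transpose_mat:
  fixes f :: "'b::topological_space \<Rightarrow> 'a::topological_space mat"
  assumes "continuous_on S f" "f \<in> S \<rightarrow> carrier_mat n m"
  shows "continuous_on S (\<lambda>x. transpose_mat (f x))"
proof -
  have "continuous_on S (\<lambda>x. transpose_mat (f x) $$ (i, j))" if "i < m" "j < n" for i j
  proof (rule iffD1[OF continuous_on_cong[OF refl]])
    show "continuous_on S (\<lambda>x. f x $$ (j, i))"
      using that by (intro continuous_on_entry[OF assms])
    show "f x $$ (j, i) = transpose_mat (f x) $$ (i, j)" if "x \<in> S" for x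
    proof -
      have "f x \<in> carrier_mat n m" using assms that by auto
      then show ?thesis using \<open>i < m\<close> \<open>j < n\<close> by simp
    qed
  qed
  then show ?thesis using assms
    by (subst continuous_on_mat_iff[of _ _ m n]) (auto simp: Pi_iff)
qed

lemma continuous_on_four_block_mat:
  fixes a b c d :: "'b::topological_space \<Rightarrow> 'a::{topological_space, zero} mat"
  assumes a: "continuous_on S a" "a \<in> S \<rightarrow> carrier_mat n1 m1"
    and b: "continuous_on S b" "b \<in> S \<rightarrow> carrier_mat n1 m2"
    and c: "continuous_on S c" "c \<in> S \<rightarrow> carrier_mat n2 m1"
    and d: "continuous_on S d" "d \<in> S \<rightarrow> carrier_mat n2 m2"
  shows "continuous_on S (\<lambda>x. four_block_mat (a x) (b x) (c x) (d x))"
proof -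
  let ?f = "\<lambda>x. four_block_mat (a x) (b x) (c x) (d x)"
  have "continuous_on S (\<lambda>x. ?f x $$ (i, j))" if "i < n1 + n2" "j < m1 + m2" for i j
  proof (rule iffD1[OF continuous_on_cong[OF refl]])
    show "continuous_on S (\<lambda>x. if i < n1 then if j < m1 then a x $$ (i, j) else b x $$ (i, j - m1)
        else if j < m1 then c x $$ (i - n1, j) else d x $$ (i - n1, j - m1))"
      using that by (cases "i < n1"; cases "j < m1")
        (auto intro!: continuous_on_entry[OF a] continuous_on_entry[OF b]
          continuous_on_entry[OF c] continuous_on_entry[OF d])
    show "(if i < n1 then if j < m1 then a x $$ (i, j) else b x $$ (i, j - m1)
        else if j < m1 then c x $$ (i - n1, j) else d x $$ (i - n1, j - m1)) = ?f x $$ (i, j)"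
      if "x \<in> S" for x
    proof -
      have "a x \<in> carrier_mat n1 m1" "d x \<in> carrier_mat n2 m2" using a d that by auto
      then show ?thesis using \<open>i < n1 + n2\<close> \<open>j < m1 + m2\<close> by simp
    qed
  qed
  then show ?thesis using a d
    by (subst continuous_on_mat_iff[of _ _ "n1 + n2" "m1 + m2"]) (auto intro!: four_block_carrier_mat)
qed

lemma continuous_on_mat_comprehension:
  fixes f :: "'b::topological_space \<Rightarrow> nat \<times> nat \<Rightarrow> 'a::topological_space"
  assumes "\<And>i j. i < r \<Longrightarrow> j < c \<Longrightarrow> continuous_on S (\<lambda>x. f x (i, j))"
  shows "continuous_on S (\<lambda>x. mat r c (f x))"
  using assms by (subst continuous_on_mat_iff[of _ _ r c]) auto

text \<open>
  By the Leibniz formula the determinant is a polynomial in the entries.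
\<close>

lemma continuous_on_det:
  "continuous_on (carrier_mat n n) (Determinant.det :: 'a::{comm_ring_1, real_normed_algebra_1} mat \<Rightarrow> 'a)"
proof (rule iffD1[OF continuous_on_cong[OF refl]])
  show "continuous_on (carrier_mat n n)
      (\<lambda>A :: 'a mat. \<Sum>\<pi> | \<pi> permutes {0..<n}. signof \<pi> * (\<Prod>i = 0..<n. A $$ (i, \<pi> i)))"
    by (intro continuous_on_sum continuous_on_mult continuous_on_const continuous_on_prod
        continuous_on_entry[OF continuous_on_id]) (auto dest: permutes_in_image)
qed (simp add: det_def')

section \<open>Positive definite matrices\<close>

definition pos_def_mats :: "nat \<Rightarrow> real mat set" where
  "pos_def_mats n = {G \<in> carrier_mat n n. transpose_mat G = G \<and>
     (\<forall>x\<in>carrier_vec n. x \<noteq> 0\<^sub>v n \<longrightarrow> 0 < scalar_prod x (G *\<^sub>v x))}"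

lemma scalar_prod_self_nonneg: "0 \<le> scalar_prod (x :: real vec) x"
  by (simp add: scalar_prod_def sum_nonneg)

lemma scalar_prod_self_pos:
  assumes "x \<in> carrier_vec n" "x \<noteq> 0\<^sub>v n"
  shows "0 < scalar_prod (x :: real vec) x"
proof -
  obtain i where "i < n" "x $ i \<noteq> 0" using assms by (metis carrier_vecD eq_vecI index_zero_vec)
  then show ?thesis using assms
    unfolding scalar_prod_def by (intro sum_pos2[of _ i]) (auto simp: zero_less_mult_iff neq_iff)
qed

lemma transpose_smult_mat: "transpose_mat (s \<cdot>\<^sub>m A) = s \<cdot>\<^sub>m transpose_mat A"
  by (rule eq_matI) auto

lemma one_plus_gram_pos_def:
  assumes C: "C \<in> carrier_mat m n" and s: "0 \<le> s"
  shows "1\<^sub>m n + s \<cdot>\<^sub>m (transpose_mat C * C) \<in> pos_def_mats n"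
proof -
  let ?G = "1\<^sub>m n + s \<cdot>\<^sub>m (transpose_mat C * C)"
  have "0 < scalar_prod x (?G *\<^sub>v x)" if x: "x \<in> carrier_vec n" "x \<noteq> 0\<^sub>v n" for x
  proof -
    have smult: "(s \<cdot>\<^sub>m M) *\<^sub>v x = s \<cdot>\<^sub>v (M *\<^sub>v x)" if "M \<in> carrier_mat n n" for M
      using that x by (intro eq_vecI) simp_all
    have "?G *\<^sub>v x = x + s \<cdot>\<^sub>v (transpose_mat C *\<^sub>v (C *\<^sub>v x))"
      using C x by (simp add: add_mult_distrib_mat_vec[of _ n n] smult[of "transpose_mat C * C"])
    then have "scalar_prod x (?G *\<^sub>v x)
        = scalar_prod x x + s * scalar_prod x (transpose_mat C *\<^sub>v (C *\<^sub>v x))"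
      using C x by (simp add: scalar_prod_add_distrib[of _ n])
    also have "scalar_prod x (transpose_mat C *\<^sub>v (C *\<^sub>v x)) = scalar_prod (C *\<^sub>v x) (C *\<^sub>v x)"
      using transpose_vec_mult_scalar[OF C x(1), of "C *\<^sub>v x"] C x
      by (simp add: comm_scalar_prod[of _ n])
    finally show ?thesis
      using scalar_prod_self_pos[OF x] s scalar_prod_self_nonneg[of "C *\<^sub>v x"]
      by (simp add: add_pos_nonneg)
  qed
  moreover have "transpose_mat ?G = ?G"
    using C by (simp add: transpose_add[of _ n n] transpose_smult_mat transpose_mult[of _ n m])
  ultimately show ?thesis
    using C by (auto simp: pos_def_mats_def)
qed

text \<open>
  \<open>E\<close> subtracts multiples of the first column from the others so as to clear the first row;
  \<open>E\<^sup>T\<close> does the same to the rows. What is left in the lower right corner is the Schur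
  complement of the entry \<open>g\<close>.
\<close>

lemma block_column_elimination:
  fixes v G :: "real mat" and g :: real
  assumes v: "v \<in> carrier_mat 1 n" and G: "G \<in> carrier_mat n n" and g: "g \<noteq> 0"
  defines "E \<equiv> four_block_mat (1\<^sub>m 1) ((- 1 / g) \<cdot>\<^sub>m v) (0\<^sub>m n 1) (1\<^sub>m n)"
  shows "transpose_mat E * (four_block_mat (g \<cdot>\<^sub>m 1\<^sub>m 1) v (transpose_mat v) G * E) =
    four_block_mat (g \<cdot>\<^sub>m 1\<^sub>m 1) (0\<^sub>m 1 n) (0\<^sub>m n 1) (G + (- 1 / g) \<cdot>\<^sub>m (transpose_mat v * v))"
proof -
  let ?S = "G + (- 1 / g) \<cdot>\<^sub>m (transpose_mat v * v)"
  have S: "?S \<in> carrier_mat n n" using v G by auto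
  have "four_block_mat (g \<cdot>\<^sub>m 1\<^sub>m 1) v (transpose_mat v) G * E =
      four_block_mat (g \<cdot>\<^sub>m 1\<^sub>m 1) (0\<^sub>m 1 n) (transpose_mat v) ?S"
    unfolding E_def
  proof (subst mult_four_block_mat[of _ 1 1 _ n _ n _ _ 1 _ n], goal_cases)
    case 9
    have "g \<cdot>\<^sub>m 1\<^sub>m 1 * 1\<^sub>m 1 + v * 0\<^sub>m n 1 = g \<cdot>\<^sub>m 1\<^sub>m 1"
      using v by (intro eq_matI) auto
    moreover have "g \<cdot>\<^sub>m 1\<^sub>m 1 * ((- 1 / g) \<cdot>\<^sub>m v) + v * 1\<^sub>m n = 0\<^sub>m 1 n"
      using v g by (simp add: mult_smult_assoc_mat[of _ 1 1 _ n]) (intro eq_matI, auto)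
    moreover have "transpose_mat v * 1\<^sub>m 1 + G * 0\<^sub>m n 1 = transpose_mat v"
      using v G by simp
    moreover have "transpose_mat v * ((- 1 / g) \<cdot>\<^sub>m v) + G * 1\<^sub>m n = ?S"
      using v G by (simp add: mult_smult_distrib[of _ n 1 _ n] comm_add_mat[of _ n n])
    ultimately show ?case by simp
  qed (use v G in auto)
  moreover have "transpose_mat E =
      four_block_mat (1\<^sub>m 1) (0\<^sub>m 1 n) ((- 1 / g) \<cdot>\<^sub>m transpose_mat v) (1\<^sub>m n)"
    unfolding E_def using v
    by (subst transpose_four_block_mat[of _ 1 1 _ n _ n]) (auto simp: transpose_smult_mat)
  moreover have "four_block_mat (1\<^sub>m 1) (0\<^sub>m 1 n) ((- 1 / g) \<cdot>\<^sub>m transpose_mat v) (1\<^sub>m n) *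
      four_block_mat (g \<cdot>\<^sub>m 1\<^sub>m 1) (0\<^sub>m 1 n) (transpose_mat v) ?S =
      four_block_mat (g \<cdot>\<^sub>m 1\<^sub>m 1) (0\<^sub>m 1 n) (0\<^sub>m n 1) ?S"
  proof -
    have "1\<^sub>m 1 * (g \<cdot>\<^sub>m 1\<^sub>m 1) + 0\<^sub>m 1 n * transpose_mat v = g \<cdot>\<^sub>m (1\<^sub>m 1 :: real mat)"
      using v by simp
    moreover have "1\<^sub>m 1 * 0\<^sub>m 1 n + 0\<^sub>m 1 n * ?S = 0\<^sub>m 1 n"
      unfolding left_mult_zero_mat[OF S] by simp
    moreover have "(- 1 / g) \<cdot>\<^sub>m transpose_mat v * (g \<cdot>\<^sub>m 1\<^sub>m 1) + 1\<^sub>m n * transpose_mat v = 0\<^sub>m n 1"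
      using v g by (simp add: mult_smult_distrib[of _ n 1 _ 1]) (intro eq_matI, auto)
    moreover have "(- 1 / g) \<cdot>\<^sub>m transpose_mat v * 0\<^sub>m 1 n + 1\<^sub>m n * ?S = ?S"
      using S v by simp
    ultimately show ?thesis
      by (subst mult_four_block_mat[of _ 1 1 _ n _ n _ _ 1 _ n]) (use v S in \<open>simp_all only:, auto\<close>)
  qed
  ultimately show ?thesis by simp
qed

text \<open>
  The corner is the value of the quadratic form at the first unit vector.
\<close>

lemma pos_def_corner_pos:
  assumes G: "G \<in> pos_def_mats (Suc n)"
  shows "0 < G $$ (0, 0)"
proof -
  have "unit_vec (Suc n) 0 \<noteq> (0\<^sub>v (Suc n) :: real vec)"
    by (metis index_unit_vec(2) index_zero_vec(1) zero_less_Suc zero_neq_one)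
  then have "0 < scalar_prod (unit_vec (Suc n) 0) (G *\<^sub>v unit_vec (Suc n) 0)"
    using G by (auto simp: pos_def_mats_def)
  moreover have "G \<in> carrier_mat (Suc n) (Suc n)" using G by (simp add: pos_def_mats_def)
  then have "scalar_prod (unit_vec (Suc n) 0) (G *\<^sub>v unit_vec (Suc n) 0) = G $$ (0, 0)"
    by (subst scalar_prod_left_unit[of _ "Suc n"])
      (auto simp: scalar_prod_right_unit[of _ "Suc n"] intro!: carrier_vecI)
  ultimately show ?thesis by simp
qed

text \<open>
  By \<open>block_column_elimination\<close> the quadratic form of the Schur complement at \<open>x\<close> is the form of the
  whole matrix at \<open>E (0, x)\<close>, a vector whose last part is \<open>x\<close> itself and which is thus nonzero.
\<close>

lemma pos_def_schur_complement:
  assumes M: "four_block_mat (g \<cdot>\<^sub>m 1\<^sub>m 1) v (transpose_mat v) G \<in> pos_def_mats (Suc n)" (is "?M \<in> _")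
    and v: "v \<in> carrier_mat 1 n" and G: "G \<in> carrier_mat n n" "transpose_mat G = G" and g: "g \<noteq> 0"
  shows "G + (- 1 / g) \<cdot>\<^sub>m (transpose_mat v * v) \<in> pos_def_mats n" (is "?S \<in> _")
proof -
  let ?E = "four_block_mat (1\<^sub>m 1) ((- 1 / g) \<cdot>\<^sub>m v) (0\<^sub>m n 1) (1\<^sub>m n)"
  have E: "?E \<in> carrier_mat (Suc n) (Suc n)" and Mc: "?M \<in> carrier_mat (Suc n) (Suc n)"
    using v G by (auto intro!: carrier_matI)
  have S: "?S \<in> carrier_mat n n" using v G by auto
  have "0 < scalar_prod x (?S *\<^sub>v x)" if x: "x \<in> carrier_vec n" "x \<noteq> 0\<^sub>v n" for x
  proof -
    \<comment> \<open>\<open>?E *\<^sub>v ?z\<close> is the vector with last part \<open>x\<close> and first part \<open>?w\<close>.\<close>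
    let ?z = "0\<^sub>v 1 @\<^sub>v x" and ?w = "((- 1 / g) \<cdot>\<^sub>m v) *\<^sub>v x"
    have z: "?z \<in> carrier_vec (Suc n)" using x by (auto intro!: carrier_vecI)
    have w: "?w \<in> carrier_vec 1" using v x by (auto intro!: carrier_vecI)
    have Ez: "?E *\<^sub>v ?z = ?w @\<^sub>v x"
      using v x w by (subst four_block_mat_mult_vec[of _ 1 1 _ n _ n]) auto
    have "?w @\<^sub>v x \<noteq> 0\<^sub>v 1 @\<^sub>v 0\<^sub>v n"
      using x w append_vec_eq[OF w zero_carrier_vec, of x "0\<^sub>v n"] by auto
    moreover have "0\<^sub>v 1 @\<^sub>v 0\<^sub>v n = (0\<^sub>v (Suc n) :: real vec)"
      by (intro eq_vecI) auto
    ultimately have "?E *\<^sub>v ?z \<noteq> 0\<^sub>v (Suc n)" using Ez by simp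
    moreover have "?E *\<^sub>v ?z \<in> carrier_vec (Suc n)" using E z by simp
    ultimately have "0 < scalar_prod (?E *\<^sub>v ?z) (?M *\<^sub>v (?E *\<^sub>v ?z))"
      using M by (auto simp: pos_def_mats_def)
    also have "\<dots> = scalar_prod (transpose_mat ?E *\<^sub>v (?M *\<^sub>v (?E *\<^sub>v ?z))) ?z"
      using transpose_vec_mult_scalar[OF E z, of "?M *\<^sub>v (?E *\<^sub>v ?z)"] E Mc z
      by (simp add: comm_scalar_prod[of _ "Suc n"])
    also have "transpose_mat ?E *\<^sub>v (?M *\<^sub>v (?E *\<^sub>v ?z)) = (transpose_mat ?E * (?M * ?E)) *\<^sub>v ?z"
      using E Mc z
      by (simp add: assoc_mult_mat_vec[of _ "Suc n" "Suc n" _ "Suc n"] del: assoc_mult_mat)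
    also have "\<dots> = 0\<^sub>v 1 @\<^sub>v (?S *\<^sub>v x)"
      unfolding block_column_elimination[OF v G(1) g]
    proof (subst four_block_mat_mult_vec[of _ 1 1 _ n _ n])
      have "g \<cdot>\<^sub>m 1\<^sub>m 1 *\<^sub>v 0\<^sub>v 1 + 0\<^sub>m 1 n *\<^sub>v x = 0\<^sub>v 1"
        using x by (intro eq_vecI) auto
      moreover have "0\<^sub>m n 1 *\<^sub>v 0\<^sub>v 1 + ?S *\<^sub>v x = ?S *\<^sub>v x"
        using S x by (intro eq_vecI) auto
      ultimately show "(g \<cdot>\<^sub>m 1\<^sub>m 1 *\<^sub>v 0\<^sub>v 1 + 0\<^sub>m 1 n *\<^sub>v x) @\<^sub>v (0\<^sub>m n 1 *\<^sub>v 0\<^sub>v 1 + ?S *\<^sub>v x) =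
          0\<^sub>v 1 @\<^sub>v (?S *\<^sub>v x)" by simp
    qed (use S x in auto)
    also have "scalar_prod (0\<^sub>v 1 @\<^sub>v (?S *\<^sub>v x)) ?z = scalar_prod (?S *\<^sub>v x) x"
      using S x by (subst scalar_prod_append[of _ 1 _ n]) auto
    also have "\<dots> = scalar_prod x (?S *\<^sub>v x)"
      using S x by (intro comm_scalar_prod[of _ n]) auto
    finally show ?thesis .
  qed
  moreover have "transpose_mat ?S = ?S"
    using v G by (simp add: transpose_add[of _ n n] transpose_smult_mat transpose_mult[of _ n 1])
  ultimately show ?thesis using S by (simp add: pos_def_mats_def)
qed

text \<open>
  Eliminate with the corner entry, apply the induction hypothesis to the Schur complement, and
  rescale the first coordinate by the inverse square root of the corner. Every ingredient depends
  continuously on \<open>G\<close>, since the corner is positive. That \<open>L\<close> maps 1 to 1 makes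
  the deformation agree with the identity map at one end and keeps block diagonal matrices fixed.
\<close>

lemma continuous_congruence_to_one:
  "\<exists>L. continuous_on (pos_def_mats n) L \<and> L \<in> pos_def_mats n \<rightarrow> carrier_mat n n \<and> L (1\<^sub>m n) = 1\<^sub>m n \<and>
     (\<forall>G\<in>pos_def_mats n. transpose_mat (L G) * (G * L G) = 1\<^sub>m n)"
proof (induction n)
  case 0
  show ?case
    by (intro exI[of _ "\<lambda>_. 1\<^sub>m 0"]) (auto intro!: eq_matI simp: pos_def_mats_def)
next
  case (Suc n)
  then obtain L where L: "continuous_on (pos_def_mats n) L" "L \<in> pos_def_mats n \<rightarrow> carrier_mat n n"
    and L_one: "L (1\<^sub>m n) = 1\<^sub>m n"
    and L_cong: "\<And>G. G \<in> pos_def_mats n \<Longrightarrow> transpose_mat (L G) * (G * L G) = 1\<^sub>m n"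
    by blast
  define g :: "real mat \<Rightarrow> real" where "g G = G $$ (0, 0)" for G
  define v :: "real mat \<Rightarrow> real mat" where "v G = mat 1 n (\<lambda>(i, j). G $$ (0, Suc j))" for G
  define R :: "real mat \<Rightarrow> real mat" where "R G = mat n n (\<lambda>(i, j). G $$ (Suc i, Suc j))" for G
  define S where "S G = R G + (- 1 / g G) \<cdot>\<^sub>m (transpose_mat (v G) * v G)" for G
  define E where "E G = four_block_mat (1\<^sub>m 1) ((- 1 / g G) \<cdot>\<^sub>m v G) (0\<^sub>m n 1) (1\<^sub>m n)" for G
  define D where
    "D G = four_block_mat ((1 / sqrt (g G)) \<cdot>\<^sub>m 1\<^sub>m 1) (0\<^sub>m 1 n) (0\<^sub>m n 1) (L (S G))" for G
  have v: "v G \<in> carrier_mat 1 n" and R: "R G \<in> carrier_mat n n" and SG: "S G \<in> carrier_mat n n"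
    and EG: "E G \<in> carrier_mat (Suc n) (Suc n)" for G
    by (auto simp: v_def R_def S_def E_def intro!: carrier_matI)
  let ?P = "pos_def_mats (Suc n)"
  have g: "0 < g G" if "G \<in> ?P" for G
    using pos_def_corner_pos[OF that] by (simp add: g_def)
  have blocks: "G = four_block_mat (g G \<cdot>\<^sub>m 1\<^sub>m 1) (v G) (transpose_mat (v G)) (R G)"
    and R_sym: "transpose_mat (R G) = R G" if "G \<in> ?P" for G
  proof -
    have G: "G \<in> carrier_mat (Suc n) (Suc n)" "transpose_mat G = G"
      using that by (auto simp: pos_def_mats_def)
    have sym: "G $$ (i, j) = G $$ (j, i)" if "i < Suc n" "j < Suc n" for i j
      using G that by (metis carrier_matD index_transpose_mat(1))
    show "transpose_mat (R G) = R G"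
      using sym by (intro eq_matI) (auto simp: R_def)
    show "G = four_block_mat (g G \<cdot>\<^sub>m 1\<^sub>m 1) (v G) (transpose_mat (v G)) (R G)"
      using G(1) sym by (intro eq_matI) (auto simp: g_def v_def R_def)
  qed
  have S: "S G \<in> pos_def_mats n" if "G \<in> ?P" for G
    unfolding S_def
    by (rule pos_def_schur_complement[OF _ v R R_sym[OF that]])
      (use that blocks[OF that] g[OF that] in auto)
  have LS: "L (S G) \<in> carrier_mat n n" if "G \<in> ?P" for G
    using L(2) S[OF that] by auto
  have DG: "D G \<in> carrier_mat (Suc n) (Suc n)" if "G \<in> ?P" for G
    using LS[OF that] by (auto simp: D_def intro!: carrier_matI)
  have contE: "continuous_on ?P E" and contD: "continuous_on ?P D"
  proof -
    have entry: "continuous_on ?P (\<lambda>G. G $$ (i, j))" if "i < Suc n" "j < Suc n" for i j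
      by (rule continuous_on_entry[OF continuous_on_id _ that]) (auto simp: pos_def_mats_def)
    have contg: "continuous_on ?P g" unfolding g_def by (rule entry) auto
    have contv: "continuous_on ?P v"
      unfolding v_def using entry by (intro continuous_on_mat_comprehension) auto
    have contR: "continuous_on ?P R"
      unfolding R_def using entry by (intro continuous_on_mat_comprehension) auto
    have quot: "continuous_on ?P (\<lambda>G. - 1 / g G)" "continuous_on ?P (\<lambda>G. 1 / sqrt (g G))"
      using g by (force intro!: continuous_intros contg)+
    show "continuous_on ?P E"
      unfolding E_def using v
      by (intro continuous_on_four_block_mat[of _ _ 1 1 _ n _ n] continuous_on_const
          continuous_on_mat_smult[of _ _ _ 1 n] quot contv) auto
    have "continuous_on ?P S"
      unfolding S_def using v R mult_carrier_mat[OF transpose_carrier_mat[THEN iffD2, OF v] v]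
      by (intro continuous_on_mat_add[of _ _ n n] continuous_on_mat_smult[of _ _ _ n n]
          continuous_on_mat_mult[of _ _ n 1 _ n] continuous_on_transpose_mat[of _ _ 1 n]
          quot contv contR) auto
    then have "continuous_on ?P (\<lambda>G. L (S G))"
      by (rule continuous_on_compose2[OF L(1)]) (use S in auto)
    then show "continuous_on ?P D"
      unfolding D_def using LS
      by (intro continuous_on_four_block_mat[of _ _ 1 1 _ n _ n] continuous_on_const
          continuous_on_mat_smult[of _ _ _ 1 1] quot) auto
  qed
  show ?case
  proof (intro exI[of _ "\<lambda>G. E G * D G"] conjI ballI)
    show "continuous_on ?P (\<lambda>G. E G * D G)"
      using EG DG by (intro continuous_on_mat_mult[of _ _ "Suc n" "Suc n" _ "Suc n"] contE contD) auto
    show "(\<lambda>G. E G * D G) \<in> ?P \<rightarrow> carrier_mat (Suc n) (Suc n)"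
      using mult_carrier_mat[OF EG DG] by auto
    have "g (1\<^sub>m (Suc n)) = 1" "v (1\<^sub>m (Suc n)) = 0\<^sub>m 1 n" "R (1\<^sub>m (Suc n)) = 1\<^sub>m n"
      by (auto simp: g_def v_def R_def)
    moreover have "(0\<^sub>m n 1 :: real mat) * 0\<^sub>m 1 n = 0\<^sub>m n n" by simp
    ultimately have "S (1\<^sub>m (Suc n)) = 1\<^sub>m n" "E (1\<^sub>m (Suc n)) = 1\<^sub>m (Suc n)"
      by (auto simp: S_def E_def)
    moreover from this have "D (1\<^sub>m (Suc n)) = 1\<^sub>m (Suc n)"
      using \<open>g _ = 1\<close> L_one by (intro eq_matI) (auto simp: D_def)
    ultimately show "E (1\<^sub>m (Suc n)) * D (1\<^sub>m (Suc n)) = 1\<^sub>m (Suc n)" by simp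
  next
    fix G assume G: "G \<in> ?P"
    have Gc: "G \<in> carrier_mat (Suc n) (Suc n)" using G by (simp add: pos_def_mats_def)
    note c = Gc EG[of G] DG[OF G]
    have "transpose_mat (E G * D G) * (G * (E G * D G)) =
        transpose_mat (D G) * ((transpose_mat (E G) * (G * E G)) * D G)"
      using c by (simp add: transpose_mult[of _ "Suc n" "Suc n" _ "Suc n"]
          assoc_mult_mat[of _ "Suc n" "Suc n" _ "Suc n" _ "Suc n"])
    also have "transpose_mat (E G) * (G * E G) =
        four_block_mat (g G \<cdot>\<^sub>m 1\<^sub>m 1) (0\<^sub>m 1 n) (0\<^sub>m n 1) (S G)"
      using block_column_elimination[OF v R, of "g G" G G] g[OF G]
      unfolding blocks[OF G, symmetric] E_def S_def by simp
    also have "\<dots> * D G = four_block_mat (sqrt (g G) \<cdot>\<^sub>m 1\<^sub>m 1) (0\<^sub>m 1 n) (0\<^sub>m n 1) (S G * L (S G))"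
      unfolding D_def
    proof -
      have "(g G \<cdot>\<^sub>m 1\<^sub>m 1) * ((1 / sqrt (g G)) \<cdot>\<^sub>m 1\<^sub>m 1) + 0\<^sub>m 1 n * 0\<^sub>m n 1 = sqrt (g G) \<cdot>\<^sub>m 1\<^sub>m 1"
        using g[OF G] by (intro eq_matI) (auto simp: real_div_sqrt)
      moreover have "(g G \<cdot>\<^sub>m 1\<^sub>m 1) * 0\<^sub>m 1 n + 0\<^sub>m 1 n * L (S G) = 0\<^sub>m 1 n"
        using LS[OF G] by simp
      moreover have "0\<^sub>m n 1 * ((1 / sqrt (g G)) \<cdot>\<^sub>m 1\<^sub>m 1) + S G * 0\<^sub>m n 1 = 0\<^sub>m n 1"
        using SG[of G] by simp
      moreover have "0\<^sub>m n 1 * 0\<^sub>m 1 n + S G * L (S G) = S G * L (S G)"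
        using LS[OF G] SG[of G] by simp
      ultimately show "four_block_mat (g G \<cdot>\<^sub>m 1\<^sub>m 1) (0\<^sub>m 1 n) (0\<^sub>m n 1) (S G) *
          four_block_mat ((1 / sqrt (g G)) \<cdot>\<^sub>m 1\<^sub>m 1) (0\<^sub>m 1 n) (0\<^sub>m n 1) (L (S G)) =
          four_block_mat (sqrt (g G) \<cdot>\<^sub>m 1\<^sub>m 1) (0\<^sub>m 1 n) (0\<^sub>m n 1) (S G * L (S G))"
        by (subst mult_four_block_mat[of _ 1 1 _ n _ n _ _ 1 _ n])
          (use LS[OF G] SG in \<open>simp_all only:, auto\<close>)
    qed
    also have "transpose_mat (D G) =
        four_block_mat ((1 / sqrt (g G)) \<cdot>\<^sub>m 1\<^sub>m 1) (0\<^sub>m 1 n) (0\<^sub>m n 1) (transpose_mat (L (S G)))"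
      unfolding D_def using LS[OF G]
      by (subst transpose_four_block_mat[of _ 1 1 _ n _ n]) (auto simp: transpose_smult_mat)
    also have "\<dots> * four_block_mat (sqrt (g G) \<cdot>\<^sub>m 1\<^sub>m 1) (0\<^sub>m 1 n) (0\<^sub>m n 1) (S G * L (S G)) =
        four_block_mat (1\<^sub>m 1) (0\<^sub>m 1 n) (0\<^sub>m n 1) (1\<^sub>m n)"
    proof -
      have SL: "S G * L (S G) \<in> carrier_mat n n" using LS[OF G] SG[of G] by simp
      have "((1 / sqrt (g G)) \<cdot>\<^sub>m 1\<^sub>m 1) * (sqrt (g G) \<cdot>\<^sub>m 1\<^sub>m 1) + 0\<^sub>m 1 n * 0\<^sub>m n 1 = (1\<^sub>m 1 :: real mat)"
        using g[OF G] by (intro eq_matI) auto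
      moreover have "((1 / sqrt (g G)) \<cdot>\<^sub>m 1\<^sub>m 1) * 0\<^sub>m 1 n + 0\<^sub>m 1 n * (S G * L (S G)) = 0\<^sub>m 1 n"
        unfolding left_mult_zero_mat[OF SL] by simp
      moreover have "0\<^sub>m n 1 * (sqrt (g G) \<cdot>\<^sub>m 1\<^sub>m 1) + transpose_mat (L (S G)) * 0\<^sub>m n 1 = 0\<^sub>m n 1"
        using LS[OF G] by simp
      moreover have "0\<^sub>m n 1 * 0\<^sub>m 1 n + transpose_mat (L (S G)) * (S G * L (S G)) = 1\<^sub>m n"
        unfolding L_cong[OF S[OF G]] by simp
      ultimately show ?thesis
        by (subst mult_four_block_mat[of _ 1 1 _ n _ n _ _ 1 _ n])
          (use LS[OF G] SL in \<open>simp_all only:, auto\<close>)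
    qed
    finally show "transpose_mat (E G * D G) * (G * (E G * D G)) = 1\<^sub>m (Suc n)" by simp
  qed
qed

section \<open>The indefinite orthogonal group\<close>

definition block :: "nat \<Rightarrow> nat \<Rightarrow> nat \<Rightarrow> nat \<Rightarrow> 'a mat \<Rightarrow> 'a mat" where
  "block i j r c A = mat r c (\<lambda>(k, l). A $$ (i + k, j + l))"

lemma block_carrier [simp]: "block i j r c A \<in> carrier_mat r c"
  by (simp add: block_def)

lemma dim_block [simp]: "dim_row (block i j r c A) = r" "dim_col (block i j r c A) = c"
  by (simp_all add: block_def)

lemma four_block_mat_blocks:
  assumes "A \<in> carrier_mat (p + q) (p + q)"
  shows "A = four_block_mat (block 0 0 p p A) (block 0 p p q A) (block p 0 q p A) (block p p q q A)"
  using assms by (intro eq_matI) (auto simp: block_def)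

lemma blocks_four_block_mat:
  assumes "a \<in> carrier_mat p p" "b \<in> carrier_mat p q" "c \<in> carrier_mat q p" "d \<in> carrier_mat q q"
  shows "block 0 0 p p (four_block_mat a b c d) = a" "block 0 p p q (four_block_mat a b c d) = b"
    "block p 0 q p (four_block_mat a b c d) = c" "block p p q q (four_block_mat a b c d) = d"
  using assms by (auto simp: block_def)

lemma four_block_mat_eq_iff:
  assumes "a \<in> carrier_mat p p" "b \<in> carrier_mat p q" "c \<in> carrier_mat q p" "d \<in> carrier_mat q q"
    and "a' \<in> carrier_mat p p" "b' \<in> carrier_mat p q" "c' \<in> carrier_mat q p" "d' \<in> carrier_mat q q"
  shows "four_block_mat a b c d = four_block_mat a' b' c' d' \<longleftrightarrow> a = a' \<and> b = b' \<and> c = c' \<and> d = d'"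
  using blocks_four_block_mat[OF assms(1-4)] blocks_four_block_mat[OF assms(5-8)] by metis

lemma continuous_on_block:
  assumes "continuous_on S f" "f \<in> S \<rightarrow> carrier_mat n m" "i + r \<le> n" "j + c \<le> m"
  shows "continuous_on S (\<lambda>x. block i j r c (f x))"
  unfolding block_def using assms
  by (intro continuous_on_mat_comprehension) (auto intro!: continuous_on_entry[OF assms(1,2)])

text \<open>
  The group \<open>O(p,q)\<close>. The condition that \<open>A\<close> preserves the form is one polynomial equation and is
  easier to split into blocks than the condition on the inverse of \<open>A\<close>.
\<close>

definition indef_orthogonal :: "nat \<Rightarrow> nat \<Rightarrow> real mat set" where
  "indef_orthogonal p q =
    {A \<in> carrier_mat (p + q) (p + q). transpose_mat A * (sig_mat p q * A) = sig_mat p q}"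

lemma sig_mat_carrier: "sig_mat p q \<in> carrier_mat (p + q) (p + q)"
  by (simp add: sig_mat_def)

lemma sig_mat_square: "sig_mat p q * sig_mat p q = 1\<^sub>m (p + q)"
  unfolding sig_mat_def mat_diag_diag by (auto simp: mat_diag_def)

lemma sig_mat_four_block:
  "sig_mat p q = four_block_mat (1\<^sub>m p) (0\<^sub>m p q) (0\<^sub>m q p) ((- 1) \<cdot>\<^sub>m 1\<^sub>m q)"
  by (rule eq_matI) (auto simp: sig_mat_def mat_diag_def)

lemma mat_eq_iff_entries:
  assumes "A \<in> carrier_mat n m" "B \<in> carrier_mat n m"
  shows "A = B \<longleftrightarrow> (\<forall>i<n. \<forall>j<m. A $$ (i, j) = B $$ (i, j))"
  using assms by (auto intro!: eq_matI)

text \<open>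
  The minus sign of the form enters the block products as a scalar factor, hence the shape of the
  left-hand side.
\<close>

lemma mat_diff_eq_iff:
  assumes "(X :: real mat) \<in> carrier_mat n m" "Y \<in> carrier_mat n m" "Z \<in> carrier_mat n m"
  shows "X + (- 1) \<cdot>\<^sub>m Y = Z \<longleftrightarrow> X = Z + Y"
proof -
  have "X + (- 1) \<cdot>\<^sub>m Y \<in> carrier_mat n m" "Z + Y \<in> carrier_mat n m" using assms by auto
  then show ?thesis
    unfolding mat_eq_iff_entries[OF \<open>X + _ \<in> _\<close> assms(3)] mat_eq_iff_entries[OF assms(1) \<open>Z + Y \<in> _\<close>]
    using assms by (auto simp: algebra_simps)
qed

lemma four_block_indef_orthogonal_iff:
  assumes "a \<in> carrier_mat p p" "b \<in> carrier_mat p q" "c \<in> carrier_mat q p" "d \<in> carrier_mat q q"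
  shows "four_block_mat a b c d \<in> indef_orthogonal p q \<longleftrightarrow>
    transpose_mat a * a = 1\<^sub>m p + transpose_mat c * c \<and>
    transpose_mat d * d = 1\<^sub>m q + transpose_mat b * b \<and>
    transpose_mat a * b = transpose_mat c * d"
proof -
  let ?T = "transpose_mat"
  note car = assms
  have "sig_mat p q * four_block_mat a b c d = four_block_mat a b ((- 1) \<cdot>\<^sub>m c) ((- 1) \<cdot>\<^sub>m d)"
    unfolding sig_mat_def using assms
    by (subst mat_diag_mult_left[of _ _ "p + q"]) (auto intro!: eq_matI)
  then have "?T (four_block_mat a b c d) * (sig_mat p q * four_block_mat a b c d) =
      four_block_mat (?T a) (?T c) (?T b) (?T d) * four_block_mat a b ((- 1) \<cdot>\<^sub>m c) ((- 1) \<cdot>\<^sub>m d)"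
    using transpose_four_block_mat[OF assms] by simp
  also have "\<dots> = four_block_mat (?T a * a + (- 1) \<cdot>\<^sub>m (?T c * c)) (?T a * b + (- 1) \<cdot>\<^sub>m (?T c * d))
      (?T b * a + (- 1) \<cdot>\<^sub>m (?T d * c)) (?T b * b + (- 1) \<cdot>\<^sub>m (?T d * d))"
    using assms
    by (subst mult_four_block_mat[of _ p p _ q _ q _ _ p _ q])
      (auto simp: mult_smult_distrib[of _ p q _ p] mult_smult_distrib[of _ p q _ q]
        mult_smult_distrib[of _ q q _ p] mult_smult_distrib[of _ q q _ q])
  finally have prod: "?T (four_block_mat a b c d) * (sig_mat p q * four_block_mat a b c d) = \<dots>" .
  have pp: "?T a * a \<in> carrier_mat p p" "?T c * c \<in> carrier_mat p p"
    and pq: "?T a * b \<in> carrier_mat p q" "?T c * d \<in> carrier_mat p q"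
    and qp: "?T b * a \<in> carrier_mat q p" "?T d * c \<in> carrier_mat q p"
    and qq: "?T b * b \<in> carrier_mat q q" "?T d * d \<in> carrier_mat q q"
    using assms by auto
  have "four_block_mat a b c d \<in> indef_orthogonal p q \<longleftrightarrow>
      ?T a * a + (- 1) \<cdot>\<^sub>m (?T c * c) = 1\<^sub>m p \<and> ?T a * b + (- 1) \<cdot>\<^sub>m (?T c * d) = 0\<^sub>m p q \<and>
      ?T b * a + (- 1) \<cdot>\<^sub>m (?T d * c) = 0\<^sub>m q p \<and> ?T b * b + (- 1) \<cdot>\<^sub>m (?T d * d) = (- 1) \<cdot>\<^sub>m 1\<^sub>m q"
    unfolding indef_orthogonal_def mem_Collect_eq prod
    unfolding sig_mat_four_block
    using pp pq qp qq assms
    by (subst four_block_mat_eq_iff[of _ p _ q]) auto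
  also have "\<dots> \<longleftrightarrow> ?T a * a = 1\<^sub>m p + ?T c * c \<and> ?T a * b = ?T c * d \<and> ?T b * a = ?T d * c \<and>
      ?T b * b = (- 1) \<cdot>\<^sub>m 1\<^sub>m q + ?T d * d"
    using mat_diff_eq_iff[OF pp one_carrier_mat] mat_diff_eq_iff[OF pq zero_carrier_mat]
      mat_diff_eq_iff[OF qp zero_carrier_mat] mat_diff_eq_iff[OF qq, of "(- 1) \<cdot>\<^sub>m 1\<^sub>m q"] pq qp
    by simp
  finally have "four_block_mat a b c d \<in> indef_orthogonal p q \<longleftrightarrow>
      ?T a * a = 1\<^sub>m p + ?T c * c \<and> ?T a * b = ?T c * d \<and> ?T b * a = ?T d * c \<and>
      ?T b * b = (- 1) \<cdot>\<^sub>m 1\<^sub>m q + ?T d * d" .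
  moreover have "?T b * b = (- 1) \<cdot>\<^sub>m 1\<^sub>m q + ?T d * d \<longleftrightarrow> ?T d * d = 1\<^sub>m q + ?T b * b"
  proof -
    have c: "(- 1) \<cdot>\<^sub>m 1\<^sub>m q + ?T d * d \<in> carrier_mat q q" "1\<^sub>m q + ?T b * b \<in> carrier_mat q q"
      using qq by auto
    have "?T b * b = (- 1) \<cdot>\<^sub>m 1\<^sub>m q + ?T d * d \<longleftrightarrow>
        (\<forall>i<q. \<forall>j<q. (?T b * b) $$ (i, j) = - (1\<^sub>m q $$ (i, j)) + (?T d * d) $$ (i, j))"
      unfolding mat_eq_iff_entries[OF qq(1) c(1)] using carrier_matD[OF qq(2)]
      by (simp del: index_mult_mat(1) index_one_mat(1))
    also have "\<dots> \<longleftrightarrow> (\<forall>i<q. \<forall>j<q. (?T d * d) $$ (i, j) = 1\<^sub>m q $$ (i, j) + (?T b * b) $$ (i, j))"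
      by (intro all_cong1 imp_cong refl) linarith
    also have "\<dots> \<longleftrightarrow> ?T d * d = 1\<^sub>m q + ?T b * b"
      unfolding mat_eq_iff_entries[OF qq(2) c(2)] using carrier_matD[OF qq(1)]
      by (simp del: index_mult_mat(1) index_one_mat(1))
    finally show ?thesis .
  qed
  moreover have "?T b * a = ?T d * c" if "?T a * b = ?T c * d"
    using arg_cong[OF that, of ?T] assms
    by (simp add: transpose_mult[of _ p p _ q] transpose_mult[of _ p q _ q])
  ultimately show ?thesis by blast
qed

lemma orthogonal_iff:
  "A \<in> indef_orthogonal n 0 \<longleftrightarrow> A \<in> carrier_mat n n \<and> transpose_mat A * A = 1\<^sub>m n"
proof -
  have "sig_mat n 0 = 1\<^sub>m n" by (rule eq_matI) (auto simp: sig_mat_def mat_diag_def)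
  then show ?thesis by (auto simp: indef_orthogonal_def)
qed

lemma indef_orthogonal_det_square:
  assumes "A \<in> indef_orthogonal p q"
  shows "Determinant.det A * Determinant.det A = 1"
proof -
  let ?s = "sig_mat p q"
  note s = sig_mat_carrier[of p q]
  have A: "A \<in> carrier_mat (p + q) (p + q)" "transpose_mat A * (?s * A) = ?s"
    using assms by (auto simp: indef_orthogonal_def)
  have "Determinant.det A * (Determinant.det ?s * Determinant.det A) = Determinant.det ?s"
    using arg_cong[OF A(2), of Determinant.det] A(1) s
    by (simp add: Determinant.det_mult[of _ "p + q"] Determinant.det_transpose[of _ "p + q"])
  moreover have "Determinant.det ?s * Determinant.det ?s = 1"
    using Determinant.det_mult[OF s s] by (simp add: sig_mat_square)
  ultimately show ?thesis
    by (metis (no_types, opaque_lifting) mult.commute mult.left_commute mult_1)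
qed

text \<open>
  Since \<open>sig_mat p q\<close> is its own inverse, \<open>A\<^sup>T I A = I\<close> says that \<open>I A\<^sup>T I\<close> is a left inverse of
  \<open>A\<close>; for square matrices this is also a right inverse.
\<close>

lemma SOpq_eq: "SOpq p q = {A \<in> indef_orthogonal p q. Determinant.det A = 1}"
proof (intro Set.set_eqI)
  fix A
  let ?n = "p + q" and ?s = "sig_mat p q"
  let ?B = "?s * transpose_mat A * ?s"
  note s = sig_mat_carrier[of p q] and ss = sig_mat_square[of p q]
  have left_inv: "?B * A = ?s * (transpose_mat A * (?s * A))" if "A \<in> carrier_mat ?n ?n"
    using that s by (simp add: assoc_mult_mat[of _ ?n ?n _ ?n _ ?n])
  show "A \<in> SOpq p q \<longleftrightarrow> A \<in> {A \<in> indef_orthogonal p q. Determinant.det A = 1}"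
  proof
    assume A: "A \<in> SOpq p q"
    then have c: "A \<in> carrier_mat ?n ?n" by (auto simp: SOpq_def GL_def)
    then have Mc: "transpose_mat A * (?s * A) \<in> carrier_mat ?n ?n" using s by auto
    have "dim_row ?B = ?n" using s by simp
    then have "?B * A = 1\<^sub>m ?n"
      using A by (auto simp: SOpq_def Let_def inverts_mat_def)
    then have "?s * (?s * (transpose_mat A * (?s * A))) = ?s * 1\<^sub>m ?n"
      using left_inv[OF c] by simp
    then have "(?s * ?s) * (transpose_mat A * (?s * A)) = ?s"
      using s Mc by (simp add: assoc_mult_mat[OF s s Mc])
    then have "transpose_mat A * (?s * A) = ?s"
      unfolding ss left_mult_one_mat[OF Mc] .
    then show "A \<in> {A \<in> indef_orthogonal p q. Determinant.det A = 1}"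
      using A c by (auto simp: indef_orthogonal_def SOpq_def)
  next
    assume A: "A \<in> {A \<in> indef_orthogonal p q. Determinant.det A = 1}"
    then have c: "A \<in> carrier_mat ?n ?n" by (auto simp: indef_orthogonal_def)
    have Bc: "?B \<in> carrier_mat ?n ?n" using c s by auto
    have BA: "?B * A = 1\<^sub>m ?n"
      using left_inv[OF c] A by (simp add: indef_orthogonal_def ss)
    moreover have AB: "A * ?B = 1\<^sub>m ?n"
      by (rule mat_mult_left_right_inverse[OF Bc c BA])
    ultimately have inv: "inverts_mat A ?B" "inverts_mat ?B A"
      using c Bc unfolding inverts_mat_def by (metis carrier_matD(1))+
    then show "A \<in> SOpq p q"
      using A c unfolding SOpq_def GL_def Let_def invertible_mat_def by auto
  qed
qed

lemma one_in_indef_orthogonal: "1\<^sub>m (p + q) \<in> indef_orthogonal p q"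
  using one_mat_in_SOpq by (simp add: SOpq_eq)

text \<open>
  The determinant is continuous and takes only the values 1 and -1 on \<open>O(p,q)\<close>, so it is constant on
  every connected subset.
\<close>

lemma component_indef_orthogonal_subset:
  "connected_component_set (indef_orthogonal p q) (1\<^sub>m (p + q)) \<subseteq> SOpq p q"
proof -
  let ?C = "connected_component_set (indef_orthogonal p q) (1\<^sub>m (p + q))"
  have sub: "?C \<subseteq> indef_orthogonal p q" by (rule connected_component_subset)
  then have "continuous_on ?C Determinant.det"
    by (intro continuous_on_subset[OF continuous_on_det[of "p + q"]]) (auto simp: indef_orthogonal_def)
  then have "connected (Determinant.det ` ?C)"
    by (intro connected_continuous_image connected_connected_component)
  moreover have "Determinant.det ` ?C \<subseteq> {1, - 1}"
    using sub indef_orthogonal_det_square square_eq_1_iff by blast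
  then have "finite (Determinant.det ` ?C)" by (rule finite_subset) simp
  moreover have "1 \<in> Determinant.det ` ?C"
    by (rule rev_image_eqI[of "1\<^sub>m (p + q)"])
      (simp_all add: connected_component_refl one_in_indef_orthogonal)
  ultimately obtain x where "Determinant.det ` ?C = {x}" "1 \<in> Determinant.det ` ?C"
    using connected_finite_iff_sing[of "Determinant.det ` ?C"] by blast
  then have "Determinant.det A = 1" if "A \<in> ?C" for A
    using that by (metis imageI singletonD)
  then show ?thesis using sub unfolding SOpq_eq by blast
qed

lemma fundamental_group_SOpq_eq:
  "fundamental_group (SOpq p q) (1\<^sub>m (p + q)) = fundamental_group (indef_orthogonal p q) (1\<^sub>m (p + q))"
  by (rule fundamental_group_connected_component[OF component_indef_orthogonal_subset])
    (auto simp: SOpq_eq)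

lemma fundamental_group_SO_eq:
  "fundamental_group (SO n) (1\<^sub>m n) = fundamental_group (indef_orthogonal n 0) (1\<^sub>m n)"
  using fundamental_group_SOpq_eq[of n 0] by (simp add: SO_def)

text \<open>
  Two passages to a component of the identity: from \<open>SO(p,q)\<close> to \<open>SO\<^sup>+(p,q)\<close>, and in \<open>O(p,q)\<close>, where
  the component lies inside \<open>SO(p,q)\<close>.
\<close>

lemma fundamental_group_SOpq_plus_eq:
  "fundamental_group (SOpq_plus p q) (1\<^sub>m (p + q)) =
    fundamental_group (indef_orthogonal p q) (1\<^sub>m (p + q))"
  unfolding fundamental_group_SOpq_eq[symmetric] SOpq_plus_def
  by (rule fundamental_group_connected_component[OF order_refl connected_component_subset])

section \<open>Deforming onto the block diagonal matrices\<close>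

text \<open>
  The first half of the deformation: \<open>k\<close> normalises the Gram matrix that is left after scaling \<open>c\<close>
  by \<open>t\<close>, so multiplying \<open>a\<close> and \<open>t c\<close> by \<open>k\<close> restores the relation between the two blocks. It
  serves the first $p$ columns as it stands, and the last $q$ columns with \<open>d, b\<close> in place of
  \<open>a, c\<close>.
\<close>

lemma gram_rescale:
  fixes a c k :: "real mat"
  assumes a: "a \<in> carrier_mat m p" and c: "c \<in> carrier_mat r p" and k: "k \<in> carrier_mat p p"
    and gram: "transpose_mat a * a = 1\<^sub>m p + transpose_mat c * c"
    and norm: "transpose_mat k * ((1\<^sub>m p + (1 - t\<^sup>2) \<cdot>\<^sub>m (transpose_mat c * c)) * k) = 1\<^sub>m p"
  shows "transpose_mat (a * k) * (a * k) =
    1\<^sub>m p + transpose_mat (t \<cdot>\<^sub>m (c * k)) * (t \<cdot>\<^sub>m (c * k))"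
proof -
  let ?T = "transpose_mat"
  let ?C = "?T c * c" and ?N = "1\<^sub>m p + (1 - t\<^sup>2) \<cdot>\<^sub>m (?T c * c)"
  have C: "?C \<in> carrier_mat p p" and N: "?N \<in> carrier_mat p p" using c by auto
  have kT: "?T k \<in> carrier_mat p p" using k by simp
  \<comment> \<open>Split off the part that \<open>k\<close> normalises; the remainder is the Gram matrix of the scaled block.\<close>
  have split: "1\<^sub>m p + ?C = ?N + t\<^sup>2 \<cdot>\<^sub>m ?C"
    using C by (intro eq_matI) (auto simp: algebra_simps simp del: index_mult_mat(1))
  have "?T (a * k) * (a * k) = ?T k * ((?T a * a) * k)"
    using a k by (simp add: transpose_mult[of _ m p _ p] assoc_mult_mat[of _ p p _ m _ p]
        assoc_mult_mat[of _ p m _ p _ p])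
  also have "\<dots> = ?T k * (?N * k + (t\<^sup>2 \<cdot>\<^sub>m ?C) * k)"
    unfolding gram split using C N k by (simp add: add_mult_distrib_mat[of _ p p _ _ p])
  also have "\<dots> = ?T k * (?N * k) + ?T k * ((t\<^sup>2 \<cdot>\<^sub>m ?C) * k)"
    by (rule mult_add_distrib_mat[OF kT mult_carrier_mat[OF N k] mult_carrier_mat[OF _ k]]) (use C in simp)
  also have "?T k * ((t\<^sup>2 \<cdot>\<^sub>m ?C) * k) = t\<^sup>2 \<cdot>\<^sub>m (?T k * (?C * k))"
    unfolding mult_smult_assoc_mat[OF C k]
    by (rule mult_smult_distrib[OF kT mult_carrier_mat[OF C k]])
  also have "\<dots> = ?T (t \<cdot>\<^sub>m (c * k)) * (t \<cdot>\<^sub>m (c * k))"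
  proof -
    have ck: "c * k \<in> carrier_mat r p" "?T (c * k) \<in> carrier_mat p r" using c k by auto
    have "?T (t \<cdot>\<^sub>m (c * k)) * (t \<cdot>\<^sub>m (c * k)) = t\<^sup>2 \<cdot>\<^sub>m (?T (c * k) * (c * k))"
      unfolding transpose_smult_mat
      using mult_smult_assoc_mat[OF ck(2), of "t \<cdot>\<^sub>m (c * k)" p t] mult_smult_distrib[OF ck(2,1), of t] ck
      by (intro eq_matI) (auto simp: power2_eq_square simp del: index_mult_mat(1))
    also have "?T (c * k) * (c * k) = ?T k * (?C * k)"
      using c k by (simp add: transpose_mult[of _ r p _ p] assoc_mult_mat[of _ p p _ r _ p]
          assoc_mult_mat[of _ p r _ p _ p])
    finally show ?thesis by simp
  qed
  finally show ?thesis unfolding norm .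
qed

text \<open>
  One stage of the deformation. The orthogonality of the two groups of columns persists because
  both sides of $a^T b = c^T d$ acquire the same factor $t$.
\<close>

lemma four_block_rescale_indef_orthogonal:
  assumes car: "a \<in> carrier_mat p p" "b \<in> carrier_mat p q" "c \<in> carrier_mat q p" "d \<in> carrier_mat q q"
    and A: "four_block_mat a b c d \<in> indef_orthogonal p q"
    and k: "k \<in> carrier_mat p p"
      "transpose_mat k * ((1\<^sub>m p + (1 - t\<^sup>2) \<cdot>\<^sub>m (transpose_mat c * c)) * k) = 1\<^sub>m p"
    and l: "l \<in> carrier_mat q q"
      "transpose_mat l * ((1\<^sub>m q + (1 - t\<^sup>2) \<cdot>\<^sub>m (transpose_mat b * b)) * l) = 1\<^sub>m q"
  shows "four_block_mat (a * k) (t \<cdot>\<^sub>m (b * l)) (t \<cdot>\<^sub>m (c * k)) (d * l) \<in> indef_orthogonal p q"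
proof -
  let ?T = "transpose_mat"
  note eqs = A[unfolded four_block_indef_orthogonal_iff[OF car]]
  have ak: "a * k \<in> carrier_mat p p" "?T (a * k) \<in> carrier_mat p p"
    and bl: "b * l \<in> carrier_mat p q"
    and ck: "c * k \<in> carrier_mat q p" "?T (c * k) \<in> carrier_mat p q"
    and dl: "d * l \<in> carrier_mat q q"
    using car k(1) l(1) by auto
  have ab: "?T a * b \<in> carrier_mat p q" "?T c * d \<in> carrier_mat p q" using car by auto
  have "?T (a * k) * (t \<cdot>\<^sub>m (b * l)) = t \<cdot>\<^sub>m (?T k * ((?T a * b) * l))"
    unfolding mult_smult_distrib[OF ak(2) bl] using car k(1) l(1)
    by (simp add: transpose_mult[of _ p p _ p] assoc_mult_mat[of _ p p _ p _ q]
        assoc_mult_mat[of _ p p _ q _ q])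
  also have "\<dots> = t \<cdot>\<^sub>m (?T k * ((?T c * d) * l))"
    using eqs by simp
  also have "\<dots> = ?T (t \<cdot>\<^sub>m (c * k)) * (d * l)"
    unfolding transpose_smult_mat mult_smult_assoc_mat[OF ck(2) dl] using car k(1) l(1)
    by (simp add: transpose_mult[of _ q p _ p] assoc_mult_mat[of _ p p _ q _ q]
        assoc_mult_mat[of _ p q _ q _ q])
  finally show ?thesis
    using gram_rescale[OF car(1,3) k(1) _ k(2)] gram_rescale[OF car(4,2) l(1) _ l(2)] eqs
      four_block_indef_orthogonal_iff[of "a * k" p "t \<cdot>\<^sub>m (b * l)" q "t \<cdot>\<^sub>m (c * k)" "d * l"] ak bl ck dl
    by simp
qed

lemma block_diagonal_indef_orthogonal_iff:
  assumes "u \<in> carrier_mat p p" "v \<in> carrier_mat q q"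
  shows "four_block_mat u (0\<^sub>m p q) (0\<^sub>m q p) v \<in> indef_orthogonal p q \<longleftrightarrow>
    u \<in> indef_orthogonal p 0 \<and> v \<in> indef_orthogonal q 0"
  using assms
  by (subst four_block_indef_orthogonal_iff) (auto simp: orthogonal_iff)

text \<open>
  The homotopy \<open>h\<close> scales the off-diagonal blocks by \<open>t\<close> and renormalises; it runs from the
  retraction at $t = 0$ to the identity map at $t = 1$.
\<close>

theorem fundamental_group_indef_orthogonal:
  "fundamental_group (indef_orthogonal p q) (1\<^sub>m (p + q)) \<cong>
    fundamental_group (indef_orthogonal p 0 \<times> indef_orthogonal q 0) (1\<^sub>m p, 1\<^sub>m q)"
proof -
  let ?X = "indef_orthogonal p q" and ?T = transpose_mat
  let ?Y = "indef_orthogonal p 0 \<times> indef_orthogonal q 0"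
  obtain Lp where Lp: "continuous_on (pos_def_mats p) Lp" "Lp \<in> pos_def_mats p \<rightarrow> carrier_mat p p"
      "Lp (1\<^sub>m p) = 1\<^sub>m p"
    and Lp_norm: "\<And>G. G \<in> pos_def_mats p \<Longrightarrow> ?T (Lp G) * (G * Lp G) = 1\<^sub>m p"
    using continuous_congruence_to_one by metis
  obtain Lq where Lq: "continuous_on (pos_def_mats q) Lq" "Lq \<in> pos_def_mats q \<rightarrow> carrier_mat q q"
      "Lq (1\<^sub>m q) = 1\<^sub>m q"
    and Lq_norm: "\<And>G. G \<in> pos_def_mats q \<Longrightarrow> ?T (Lq G) * (G * Lq G) = 1\<^sub>m q"
    using continuous_congruence_to_one by metis
  let ?a = "block 0 0 p p :: real mat \<Rightarrow> _" and ?b = "block 0 p p q :: real mat \<Rightarrow> _"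
    and ?c = "block p 0 q p :: real mat \<Rightarrow> _" and ?d = "block p p q q :: real mat \<Rightarrow> _"
  define Gp where "Gp t A = 1\<^sub>m p + (1 - t\<^sup>2) \<cdot>\<^sub>m (?T (?c A) * ?c A)" for t :: real and A
  define Gq where "Gq t A = 1\<^sub>m q + (1 - t\<^sup>2) \<cdot>\<^sub>m (?T (?b A) * ?b A)" for t :: real and A
  define h where "h z = (case z of (t, A) \<Rightarrow>
      four_block_mat (?a A * Lp (Gp t A)) (t \<cdot>\<^sub>m (?b A * Lq (Gq t A)))
        (t \<cdot>\<^sub>m (?c A * Lp (Gp t A))) (?d A * Lq (Gq t A)))" for z
  define F where "F A = (?a A * Lp (Gp 0 A), ?d A * Lq (Gq 0 A))" for A
  define E where "E w = (case w of (u, v) \<Rightarrow> four_block_mat u (0\<^sub>m p q) (0\<^sub>m q p) v)"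
    for w :: "real mat \<times> real mat"
  have X_carrier: "A \<in> carrier_mat (p + q) (p + q)" if "A \<in> ?X" for A
    using that by (simp add: indef_orthogonal_def)
  have pos: "Gp t A \<in> pos_def_mats p" "Gq t A \<in> pos_def_mats q" if "t \<in> {0..1}" for t A
    using that by (auto simp: Gp_def Gq_def power_le_one intro!: one_plus_gram_pos_def[OF block_carrier])
  have Lcar: "Lp (Gp t A) \<in> carrier_mat p p" "Lq (Gq t A) \<in> carrier_mat q q" if "t \<in> {0..1}" for t A
    using pos[OF that] Lp(2) Lq(2) by auto
  have car: "?a A * Lp (Gp t A) \<in> carrier_mat p p" "?b A * Lq (Gq t A) \<in> carrier_mat p q"
    "?c A * Lp (Gp t A) \<in> carrier_mat q p" "?d A * Lq (Gq t A) \<in> carrier_mat q q"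
    if "t \<in> {0..1}" for t A
    by (intro mult_carrier_mat[OF block_carrier] Lcar[OF that])+
  have L_one: "Lp (Gp 1 A) = 1\<^sub>m p" "Lq (Gq 1 A) = 1\<^sub>m q" for A
  proof -
    have "Gp 1 A = 1\<^sub>m p" "Gq 1 A = 1\<^sub>m q"
      by (auto simp: Gp_def Gq_def intro!: eq_matI)
    then show "Lp (Gp 1 A) = 1\<^sub>m p" "Lq (Gq 1 A) = 1\<^sub>m q" using Lp(3) Lq(3) by simp_all
  qed
  \<comment> \<open>Block diagonal matrices do not move, because \<open>Lp\<close> and \<open>Lq\<close> map 1 to 1.\<close>
  have L_diag: "Lp (Gp t A) = 1\<^sub>m p" "Lq (Gq t A) = 1\<^sub>m q"
    if "?b A = 0\<^sub>m p q" "?c A = 0\<^sub>m q p" for t A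
  proof -
    have "Gp t A = 1\<^sub>m p" "Gq t A = 1\<^sub>m q" using that by (auto simp: Gp_def Gq_def)
    then show "Lp (Gp t A) = 1\<^sub>m p" "Lq (Gq t A) = 1\<^sub>m q" using Lp(3) Lq(3) by simp_all
  qed
  have h_in: "h (t, A) \<in> ?X" if "t \<in> {0..1}" "A \<in> ?X" for t A
    unfolding h_def prod.case
  proof (rule four_block_rescale_indef_orthogonal)
    show "four_block_mat (?a A) (?b A) (?c A) (?d A) \<in> ?X"
      using four_block_mat_blocks[OF X_carrier[OF that(2)]] that(2) by simp
  qed (use Lcar[OF that(1)] Lp_norm[OF pos(1)[OF that(1)], of A] Lq_norm[OF pos(2)[OF that(1)], of A]
      in \<open>auto simp: Gp_def Gq_def\<close>)
  \<comment> \<open>\<open>F\<close> consists of the diagonal blocks of \<open>h\<close> at time 0; therefore it is continuous, with values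
    in \<open>?Y\<close>.\<close>
  have EF: "E (F A) = h (0, A)" for A
  proof -
    have "0 \<cdot>\<^sub>m (?b A * Lq (Gq 0 A)) = 0\<^sub>m p q" "0 \<cdot>\<^sub>m (?c A * Lp (Gp 0 A)) = 0\<^sub>m q p"
      using Lcar[of 0 A] by auto
    then show ?thesis by (simp add: E_def F_def h_def)
  qed
  have F_in: "F A \<in> ?Y" if "A \<in> ?X" for A
  proof -
    have "E (F A) \<in> ?X" unfolding EF using h_in that by simp
    then show ?thesis
      using block_diagonal_indef_orthogonal_iff[OF car(1,4)[of 0 A]] by (auto simp: E_def F_def)
  qed
  have Y_carrier: "fst w \<in> carrier_mat p p" "snd w \<in> carrier_mat q q" if "w \<in> ?Y" for w
    using that by (auto simp: orthogonal_iff)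
  have E_in: "E w \<in> ?X" if "w \<in> ?Y" for w
    using that block_diagonal_indef_orthogonal_iff[OF Y_carrier[OF that]] by (auto simp: E_def)
  have FE: "F (E w) = w" if "w \<in> ?Y" for w
  proof -
    note car = Y_carrier(1)[OF that] zero_carrier_mat zero_carrier_mat Y_carrier(2)[OF that]
    have E: "E w = four_block_mat (fst w) (0\<^sub>m p q) (0\<^sub>m q p) (snd w)"
      by (simp add: E_def split: prod.split)
    show ?thesis
      using car blocks_four_block_mat[OF car] L_diag[of "E w" 0] by (simp add: F_def E)
  qed
  have one: "1\<^sub>m (p + q) = E (1\<^sub>m p, 1\<^sub>m q)" by (simp add: E_def)
  have base_in: "(1\<^sub>m p, 1\<^sub>m q) \<in> ?Y" using one_in_indef_orthogonal[of _ 0] by auto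
  have h_base: "h (t, 1\<^sub>m (p + q)) = 1\<^sub>m (p + q)" for t
  proof -
    note blocks = blocks_four_block_mat[OF one_carrier_mat zero_carrier_mat zero_carrier_mat one_carrier_mat,
        of p q, unfolded four_block_one_mat]
    show ?thesis
      using L_diag[of "1\<^sub>m (p + q)" t] by (simp add: h_def blocks)
  qed
  have h_one: "h (1, A) = A" if "A \<in> ?X" for A
  proof -
    have "1 \<cdot>\<^sub>m M = M" for M :: "real mat" by (rule eq_matI) auto
    then show ?thesis
      using four_block_mat_blocks[OF X_carrier[OF that]] by (simp add: h_def L_one)
  qed
  have h_cont: "continuous_on ({0..1} \<times> ?X) h"
  proof -
    let ?D = "{0..1::real} \<times> ?X"
    have snd: "continuous_on ?D snd" "snd \<in> ?D \<rightarrow> carrier_mat (p + q) (p + q)"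
      using X_carrier by (auto intro: continuous_on_snd continuous_on_id)
    have t: "continuous_on ?D fst" "continuous_on ?D (\<lambda>z. 1 - (fst z)\<^sup>2)"
      by (intro continuous_intros)+
    have blocks: "continuous_on ?D (\<lambda>z. ?a (snd z))" "continuous_on ?D (\<lambda>z. ?b (snd z))"
      "continuous_on ?D (\<lambda>z. ?c (snd z))" "continuous_on ?D (\<lambda>z. ?d (snd z))"
      by (rule continuous_on_block[OF snd]; simp)+
    have gram: "?T (?c A) * ?c A \<in> carrier_mat p p" "?T (?b A) * ?b A \<in> carrier_mat q q" for A
      by (rule mult_carrier_mat[OF transpose_carrier_mat[THEN iffD2, OF block_carrier] block_carrier])+
    have "continuous_on ?D (\<lambda>z. Gp (fst z) (snd z))"
      unfolding Gp_def using gram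
      by (intro continuous_on_mat_add[of _ _ p p] continuous_on_mat_smult[of _ _ _ p p] t
          continuous_on_mat_mult[of _ _ p q _ p] continuous_on_transpose_mat[of _ _ q p] blocks
          continuous_on_const) auto
    then have Lp_cont: "continuous_on ?D (\<lambda>z. Lp (Gp (fst z) (snd z)))"
      by (rule continuous_on_compose2[OF Lp(1)]) (use pos in auto)
    have "continuous_on ?D (\<lambda>z. Gq (fst z) (snd z))"
      unfolding Gq_def using gram
      by (intro continuous_on_mat_add[of _ _ q q] continuous_on_mat_smult[of _ _ _ q q] t
          continuous_on_mat_mult[of _ _ q p _ q] continuous_on_transpose_mat[of _ _ p q] blocks
          continuous_on_const) auto
    then have Lq_cont: "continuous_on ?D (\<lambda>z. Lq (Gq (fst z) (snd z)))"
      by (rule continuous_on_compose2[OF Lq(1)]) (use pos in auto)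
    have Lcar': "(\<lambda>z. Lp (Gp (fst z) (snd z))) \<in> ?D \<rightarrow> carrier_mat p p"
      "(\<lambda>z. Lq (Gq (fst z) (snd z))) \<in> ?D \<rightarrow> carrier_mat q q"
      using Lcar by auto
    have blocks_car: "(\<lambda>z. ?a (snd z)) \<in> ?D \<rightarrow> carrier_mat p p" "(\<lambda>z. ?b (snd z)) \<in> ?D \<rightarrow> carrier_mat p q"
      "(\<lambda>z. ?c (snd z)) \<in> ?D \<rightarrow> carrier_mat q p" "(\<lambda>z. ?d (snd z)) \<in> ?D \<rightarrow> carrier_mat q q"
      by simp_all
    note prods = continuous_on_mat_mult[OF blocks(1) blocks_car(1) Lp_cont Lcar'(1)]
      continuous_on_mat_mult[OF blocks(2) blocks_car(2) Lq_cont Lcar'(2)]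
      continuous_on_mat_mult[OF blocks(3) blocks_car(3) Lp_cont Lcar'(1)]
      continuous_on_mat_mult[OF blocks(4) blocks_car(4) Lq_cont Lcar'(2)]
    have prods_car: "(\<lambda>z. ?a (snd z) * Lp (Gp (fst z) (snd z))) \<in> ?D \<rightarrow> carrier_mat p p"
      "(\<lambda>z. ?b (snd z) * Lq (Gq (fst z) (snd z))) \<in> ?D \<rightarrow> carrier_mat p q"
      "(\<lambda>z. ?c (snd z) * Lp (Gp (fst z) (snd z))) \<in> ?D \<rightarrow> carrier_mat q p"
      "(\<lambda>z. ?d (snd z) * Lq (Gq (fst z) (snd z))) \<in> ?D \<rightarrow> carrier_mat q q"
      using car by auto
    have "continuous_on ?D (\<lambda>z. four_block_mat (?a (snd z) * Lp (Gp (fst z) (snd z)))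
        (fst z \<cdot>\<^sub>m (?b (snd z) * Lq (Gq (fst z) (snd z))))
        (fst z \<cdot>\<^sub>m (?c (snd z) * Lp (Gp (fst z) (snd z)))) (?d (snd z) * Lq (Gq (fst z) (snd z))))"
      by (rule continuous_on_four_block_mat[OF prods(1) prods_car(1)
            continuous_on_mat_smult[OF t(1) prods(2) prods_car(2)] _
            continuous_on_mat_smult[OF t(1) prods(3) prods_car(3)] _ prods(4) prods_car(4)])
        (use prods_car(2,3) in \<open>simp_all add: Pi_iff\<close>)
    then show ?thesis by (simp add: h_def[abs_def] case_prod_beta)
  qed
  have F_cont: "continuous_on ?X F"
  proof -
    have "continuous_on ?X (\<lambda>A. h (0, A))"
      by (rule continuous_on_compose2[OF h_cont]) (auto intro!: continuous_intros)
    moreover have "(\<lambda>A. h (0, A)) \<in> ?X \<rightarrow> carrier_mat (p + q) (p + q)"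
      using h_in X_carrier by simp
    ultimately have cont: "continuous_on ?X (\<lambda>A. ?a (h (0, A)))" "continuous_on ?X (\<lambda>A. ?d (h (0, A)))"
      by (rule continuous_on_block; simp)+
    have "?a (h (0, A)) = fst (F A)" "?d (h (0, A)) = snd (F A)" if "A \<in> ?X" for A
    proof -
      note car = Y_carrier(1)[OF F_in[OF that]] zero_carrier_mat zero_carrier_mat
        Y_carrier(2)[OF F_in[OF that]]
      have "h (0, A) = four_block_mat (fst (F A)) (0\<^sub>m p q) (0\<^sub>m q p) (snd (F A))"
        unfolding EF[symmetric] by (simp add: E_def split: prod.split)
      then show "?a (h (0, A)) = fst (F A)" "?d (h (0, A)) = snd (F A)"
        using blocks_four_block_mat[OF car] by simp_all
    qed
    then have "(?a (h (0, A)), ?d (h (0, A))) = F A" if "A \<in> ?X" for A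
      using that by (metis prod.collapse)
    then show ?thesis
      by (rule iffD1[OF continuous_on_cong[OF refl] continuous_on_Pair[OF cont]])
  qed
  show ?thesis
  proof (rule fundamental_group_deformation_retract[of _ F _ E])
    show "continuous_on ?X F" by (rule F_cont)
    show "F \<in> ?X \<rightarrow> ?Y" using F_in by blast
    show "E \<in> ?Y \<rightarrow> ?X" using E_in by blast
    show "continuous_on ?Y E"
      unfolding E_def case_prod_beta using Y_carrier
      by (intro continuous_on_four_block_mat[of _ _ p p _ q _ q] continuous_on_const
          continuous_on_fst continuous_on_snd continuous_on_id) auto
    show "F (E w) = w" if "w \<in> ?Y" for w by (rule FE[OF that])
    show "E (1\<^sub>m p, 1\<^sub>m q) = 1\<^sub>m (p + q)" by (rule one[symmetric])
    show "F (1\<^sub>m (p + q)) = (1\<^sub>m p, 1\<^sub>m q)" unfolding one by (rule FE[OF base_in])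
    show "homotopic_with_canon (\<lambda>k. k (1\<^sub>m (p + q)) = 1\<^sub>m (p + q)) ?X ?X (E \<circ> F) id"
    proof (subst homotopic_with)
      show "(f (1\<^sub>m (p + q)) = 1\<^sub>m (p + q)) = (g (1\<^sub>m (p + q)) = 1\<^sub>m (p + q))"
        if "\<And>A. A \<in> topspace (top_of_set ?X) \<Longrightarrow> f A = g A" for f g
        using that one_in_indef_orthogonal by simp
      show "\<exists>h. continuous_map (prod_topology (top_of_set {0..1::real}) (top_of_set ?X)) (top_of_set ?X) h \<and>
          (\<forall>A\<in>topspace (top_of_set ?X). h (0, A) = (E \<circ> F) A) \<and>
          (\<forall>A\<in>topspace (top_of_set ?X). h (1, A) = id A) \<and>
          (\<forall>t\<in>{0..1::real}. h (t, 1\<^sub>m (p + q)) = 1\<^sub>m (p + q))"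
      proof (intro exI[of _ h] conjI ballI)
        have "h \<in> {0..1} \<times> ?X \<rightarrow> ?X" using h_in by auto
        then show "continuous_map (prod_topology (top_of_set {0..1::real}) (top_of_set ?X)) (top_of_set ?X) h"
          using h_cont by (simp add: subtopology_Times[symmetric] image_subset_iff_funcset)
      qed (use h_one h_base EF in simp_all)
    qed
  qed
qed

theorem theorem4p4:
  fixes p q :: nat
  shows "fundamental_group (SOpq_plus p q) (1\<^sub>m (p + q)) \<cong>
    fundamental_group (SO p) (1\<^sub>m p) \<times>\<times> fundamental_group (SO q) (1\<^sub>m q)"
proof -
  have "fundamental_group (SOpq_plus p q) (1\<^sub>m (p + q)) \<cong>
      fundamental_group (indef_orthogonal p 0 \<times> indef_orthogonal q 0) (1\<^sub>m p, 1\<^sub>m q)"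
    unfolding fundamental_group_SOpq_plus_eq by (rule fundamental_group_indef_orthogonal)
  also have "\<dots> \<cong> fundamental_group (SO p) (1\<^sub>m p) \<times>\<times> fundamental_group (SO q) (1\<^sub>m q)"
    unfolding fundamental_group_SO_eq using one_in_indef_orthogonal[of _ 0]
    by (intro fundamental_group_Times) simp_all
  finally show ?thesis .
qed

end
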